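(* Let $(\Gamma,\varkappa)$ be a graded graph and let $I\subset\Gamma$ be an ideal (regarded as a graded graph itself). Then the following hold. 1) There is a bijective correspondence between $\{\varphi\in\mathcal{H}_{ex}(\Gamma): \varphi|_{I}\neq 0\}$ and $\mathcal{H}_{ex}(I)$ (here $\varphi|_I\neq 0$ means that $\varphi$ does not vanish identically on $I$), defined by the following mutually inverse maps: $$\operatorname{Res}^{\Gamma}_{I}:\{\varphi\in\mathcal{H}_{ex}(\Gamma): \varphi|_{I}\neq 0\}\to \mathcal{H}_{ex}(I),\qquad \varphi\mapsto \varphi|_I,$$ $$\operatorname{Ext}^{\Gamma}_{I}:\mathcal{H}_{ex}(I)\to \{\varphi\in\mathcal{H}_{ex}(\Gamma): \varphi|_{I}\neq 0\},\qquad \operatorname{Ext}^{\Gamma}_{I}(\varphi)(\lambda)= \lim_{N\to\infty}\sum_{\mu\in I,\ |\mu|=N}\dim(\lambda,\mu)\varphi(\mu)\quad(\lambda\in\Gamma).$$ Furthermore, for every $\varphi\in\mathcal{H}_{ex}(I)$ and every $a\in K_0^+(\Gamma)$, $$\operatorname{Ext}^{\Gamma}_{I}(\varphi)(a)=\sup\{\varphi(b): b\in K_0^+(I),\ b\leq_K a,\ \varphi(b)<+\infty\}.$$ 2) If $\Gamma$ is a primitive graded graph, then the bijection above preserves strictly positive harmonic functions: $\mathcal{H}_{ex}^{\circ}(I)\longleftrightarrow\mathcal{H}_{ex}^{\circ}(\Gamma)$.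
   Context: Graded graphs. A graded graph is a pair $(\Gamma,\varkappa)$, where $\Gamma=\bigsqcup_{n\geq 0}\Gamma_n$ is a graded set with all $\Gamma_n$ finite and $\varkappa:\Gamma\times\Gamma\to\mathbb{R}_{\geq 0}$ satisfies: (1) if $\lambda\in\Gamma_n$, $\mu\in\Gamma_m$ and $m-n\neq 1$, then $\varkappa(\lambda,\mu)=0$; (2) for every $\lambda\in\Gamma_n$ there is $\mu\in\Gamma_{n+1}$ with $\varkappa(\lambda,\mu)\neq 0$. For $\lambda\in\Gamma_n$ put $|\lambda|=n$. Write $\lambda\nearrow\mu$ if $|\mu|-|\lambda|=1$ and $\varkappa(\lambda,\mu)\neq0$. Write $\nu\geq\mu$ if $\nu=\mu$ or there is a finite path $\mu=\lambda_0\nearrow\lambda_1\nearrow\dots\nearrow\lambda_k=\nu$. The shifted dimension is $\dim(\mu,\nu)=\sum\varkappa(\lambda_0,\lambda_1)\cdots\varkappa(\lambda_{k-1},\lambda_k)$, the sum over all paths $\mu=\lambda_0\nearrow\dots\nearrow\lambda_k=\nu$; $\dim(\mu,\mu)=1$ and $\dim(\mu,\nu)=0$ if $\nu\not\geq\mu$. An ideal is a subset $I\subset\Gamma$ such that $\lambda\in I$, $\mu\geq\lambda$ imply $\mu\in I$. An ideal is itself a graded graph, with $I_n=I\cap\Gamma_n$ and $\varkappa$ restricted. $\Gamma$ is primitive if for any $\lambda_1,\lambda_2\in\Gamma$ there is $\mu\in\Gamma$ with $\mu\geq\lambda_1$ and $\mu\geq\lambda_2$. Harmonic functions. A function $\varphi:\Gamma\to\mathbb{R}_{\geq0}\cup\{+\infty\}$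 is harmonic if $\varphi(\lambda)=\sum_{\mu:\lambda\nearrow\mu}\varkappa(\lambda,\mu)\varphi(\mu)$ for all $\lambda\in\Gamma$. Conventions: $x+(+\infty)=+\infty$ for real $x$, $(+\infty)+(+\infty)=+\infty$, $0\cdot(+\infty)=0$. $\varphi$ is finite if it takes only finite values. The finiteness ideal of $\varphi$ is $\{\lambda:\varphi(\lambda)<+\infty\}$. $K_0(\Gamma)$ is the real vector space spanned by the vertices of $\Gamma$ modulo the relations $\lambda=\sum_{\mu:\lambda\nearrow\mu}\varkappa(\lambda,\mu)\,\mu$, $\lambda\in\Gamma$. $K_0^+(\Gamma)\subset K_0(\Gamma)$ is the cone of non-negative linear combinations of vertices, and $a\geq_K b$ means $a-b\in K_0^+(\Gamma)$. A harmonic function $\varphi$ defines an $\mathbb{R}_{\geq0}$-linear map $\varphi:K_0^+(\Gamma)\to\mathbb{R}_{\geq0}\cup\{+\infty\}$. For an ideal $I$, elements of $K_0^+(I)$ are regarded as elements of $K_0^+(\Gamma)$ (non-negative combinations of vertices of $I$), and $\leq_K$ is the order of $K_0(\Gamma)$. A harmonic function $\varphi$ is semifinite if it is not finite and $\varphi(a)=\sup\{\varphi(b): b\in K_0^+(\Gamma),\ b\leq_K a,\ \varphi(b)<+\infty\}$ for every $a\in K_0^+(\Gamma)$. A finite (not identically zero) or semifinite harmonic function $\varphi$ is indecomposable if every finite or semifinite harmonic function $\varphi'$ with $\varphi'\leq\varphi$ that does not vanish identically on the finiteness ideal of $\varphi$ is equal to a constant multiple of $\varphi$ on the finiteness ideal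 of $\varphi$. $\mathcal{H}_{ex}(\Gamma)$ is the set of all indecomposable finite (not identically zero) and semifinite harmonic functions on $\Gamma$; $\mathcal{H}_{ex}^{\circ}(\Gamma)$ is the subset of those that are strictly positive ($\varphi(\lambda)>0$ for all $\lambda$, the value $+\infty$ being allowed). *)

theory Defs
  imports "HOL-Analysis.Analysis" "HOL-Analysis.Finite_Function_Topology"
begin

(* The grading is given by a rank function, so that the n-th level is
   {v \<in> verts G. grade v = n}; only the values of grade and kap on verts G are relevant. *)
record 'v ggraph =
  verts :: "'v set"
  grade :: "'v \<Rightarrow> nat"
  kap :: "'v \<Rightarrow> 'v \<Rightarrow> real"

definition level :: "'v ggraph \<Rightarrow> nat \<Rightarrow> 'v set" where
  "level G n = {v \<in> verts G. grade G v = n}"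

definition graded_graph :: "'v ggraph \<Rightarrow> bool" where
  "graded_graph G \<longleftrightarrow>
     (\<forall>n. finite (level G n)) \<and>
     (\<forall>u\<in>verts G. \<forall>v\<in>verts G. 0 \<le> kap G u v) \<and>
     (\<forall>u\<in>verts G. \<forall>v\<in>verts G. grade G v \<noteq> grade G u + 1 \<longrightarrow> kap G u v = 0) \<and>
     (\<forall>n. \<forall>u\<in>level G n. \<exists>v\<in>level G (n + 1). kap G u v \<noteq> 0)"

definition edge :: "'v ggraph \<Rightarrow> 'v \<Rightarrow> 'v \<Rightarrow> bool" where
  "edge G u v \<longleftrightarrow> u \<in> verts G \<and> v \<in> verts G \<and> grade G v = grade G u + 1 \<and> kap G u v \<noteq> 0"

definition succs :: "'v ggraph \<Rightarrow> 'v \<Rightarrow> 'v set" where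
  "succs G u = {v. edge G u v}"

(* Paths are their nonempty lists of vertices; the one-vertex list is the trivial path. *)
definition gpaths :: "'v ggraph \<Rightarrow> 'v \<Rightarrow> 'v \<Rightarrow> 'v list set" where
  "gpaths G u v = {p. p \<noteq> [] \<and> set p \<subseteq> verts G \<and> hd p = u \<and> last p = v \<and> successively (edge G) p}"

definition above :: "'v ggraph \<Rightarrow> 'v \<Rightarrow> 'v \<Rightarrow> bool" where
  "above G v u \<longleftrightarrow> gpaths G u v \<noteq> {}"

definition path_weight :: "'v ggraph \<Rightarrow> 'v list \<Rightarrow> real" where
  "path_weight G p = (\<Prod>i<length p - 1. kap G (p ! i) (p ! Suc i))"

definition gdim :: "'v ggraph \<Rightarrow> 'v \<Rightarrow> 'v \<Rightarrow> real" where
  "gdim G u v = (\<Sum>p\<in>gpaths G u v. path_weight G p)"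

definition graph_ideal :: "'v ggraph \<Rightarrow> 'v set \<Rightarrow> bool" where
  "graph_ideal G I \<longleftrightarrow> I \<subseteq> verts G \<and> (\<forall>u\<in>I. \<forall>v\<in>verts G. above G v u \<longrightarrow> v \<in> I)"

definition subgraph :: "'v ggraph \<Rightarrow> 'v set \<Rightarrow> 'v ggraph" where
  "subgraph G I = G\<lparr>verts := I\<rparr>"

definition primitive_graph :: "'v ggraph \<Rightarrow> bool" where
  "primitive_graph G \<longleftrightarrow>
     (\<forall>u\<in>verts G. \<forall>v\<in>verts G. \<exists>w\<in>verts G. above G w u \<and> above G w v)"

lemma edge_above: "edge G u v \<Longrightarrow> above G v u"
  unfolding above_def gpaths_def
  by (auto simp: edge_def intro!: exI[of _ "[u, v]"])

lemma graded_graph_subgraph: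
  assumes "graded_graph G" "graph_ideal G I"
  shows "graded_graph (subgraph G I)"
proof -
  have I: "I \<subseteq> verts G" using assms(2) by (simp add: graph_ideal_def)
  have "finite (level (subgraph G I) n)" for n
    by (rule finite_subset[of _ "level G n"])
      (use I assms(1) in \<open>auto simp: graded_graph_def level_def subgraph_def\<close>)
  moreover have "\<exists>v\<in>level (subgraph G I) (n + 1). kap (subgraph G I) u v \<noteq> 0"
    if "u \<in> level (subgraph G I) n" for n u
  proof -
    have u: "u \<in> I" "u \<in> level G n" using that I by (auto simp: level_def subgraph_def)
    then obtain v where v: "v \<in> level G (n + 1)" "kap G u v \<noteq> 0"
      using assms(1) unfolding graded_graph_def by blast
    then have "edge G u v" using u I by (auto simp: edge_def level_def)
    then have "v \<in> I"
      using u v edge_above[of G u v] assms(2) by (auto simp: graph_ideal_def level_def)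
    then show ?thesis using v by (auto simp: level_def subgraph_def)
  qed
  ultimately show ?thesis
    using assms(1) I unfolding graded_graph_def by (simp add: subgraph_def subset_iff)
qed

(* A function on the vertices is represented by its extensional version, so that equality of
   HOL functions is equality on the vertices.  In ennreal, 0 * \<infinity> = 0. *)
definition harmonic :: "'v ggraph \<Rightarrow> ('v \<Rightarrow> ennreal) \<Rightarrow> bool" where
  "harmonic G \<phi> \<longleftrightarrow> \<phi> \<in> extensional (verts G) \<and>
     (\<forall>u\<in>verts G. \<phi> u = (\<Sum>v\<in>succs G u. ennreal (kap G u v) * \<phi> v))"

definition finite_fun :: "'v ggraph \<Rightarrow> ('v \<Rightarrow> ennreal) \<Rightarrow> bool" where
  "finite_fun G \<phi> \<longleftrightarrow> (\<forall>u\<in>verts G. \<phi> u < \<infinity>)"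

definition finiteness_ideal :: "'v ggraph \<Rightarrow> ('v \<Rightarrow> ennreal) \<Rightarrow> 'v set" where
  "finiteness_ideal G \<phi> = {u \<in> verts G. \<phi> u < \<infinity>}"

definition nonvanishing_on :: "'v set \<Rightarrow> ('v \<Rightarrow> ennreal) \<Rightarrow> bool" where
  "nonvanishing_on S \<phi> \<longleftrightarrow> (\<exists>u\<in>S. \<phi> u \<noteq> 0)"

definition free_space :: "'v ggraph \<Rightarrow> ('v \<Rightarrow>\<^sub>0 real) set" where
  "free_space G = {x. Poly_Mapping.keys x \<subseteq> verts G}"

definition nonneg_combs :: "'v ggraph \<Rightarrow> ('v \<Rightarrow>\<^sub>0 real) set" where
  "nonneg_combs G = {x \<in> free_space G. \<forall>v. 0 \<le> Poly_Mapping.lookup x v}"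

definition relator :: "'v ggraph \<Rightarrow> 'v \<Rightarrow> ('v \<Rightarrow>\<^sub>0 real)" where
  "relator G u = Poly_Mapping.single u 1 - (\<Sum>v\<in>succs G u. Poly_Mapping.single v (kap G u v))"

definition K0_rel :: "'v ggraph \<Rightarrow> (('v \<Rightarrow>\<^sub>0 real) \<times> ('v \<Rightarrow>\<^sub>0 real)) set" where
  "K0_rel G = {(x, y). x \<in> free_space G \<and> y \<in> free_space G \<and> x - y \<in> span (relator G ` verts G)}"

(* Elements of K_0 are the cosets of the subspace spanned by the relators. *)
definition K0 :: "'v ggraph \<Rightarrow> ('v \<Rightarrow>\<^sub>0 real) set set" where
  "K0 G = free_space G // K0_rel G"

definition K0_plus :: "'v ggraph \<Rightarrow> ('v \<Rightarrow>\<^sub>0 real) set set" where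
  "K0_plus G = {a \<in> K0 G. a \<inter> nonneg_combs G \<noteq> {}}"

definition K0_diff :: "('v \<Rightarrow>\<^sub>0 real) set \<Rightarrow> ('v \<Rightarrow>\<^sub>0 real) set \<Rightarrow> ('v \<Rightarrow>\<^sub>0 real) set" where
  "K0_diff a b = {x - y | x y. x \<in> a \<and> y \<in> b}"

definition K0_le :: "'v ggraph \<Rightarrow> ('v \<Rightarrow>\<^sub>0 real) set \<Rightarrow> ('v \<Rightarrow>\<^sub>0 real) set \<Rightarrow> bool" where
  "K0_le G b a \<longleftrightarrow> K0_diff a b \<in> K0_plus G"

(* For an ideal I and b in K0 (subgraph G I), this is the image of b under the natural map
   to K0 G: the coset in K0 G containing b. *)
definition K0_incl :: "'v ggraph \<Rightarrow> ('v \<Rightarrow>\<^sub>0 real) set \<Rightarrow> ('v \<Rightarrow>\<^sub>0 real) set" where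
  "K0_incl G b = K0_rel G `` b"

(* The linear map on K0_plus G defined by \<phi>.  For harmonic \<phi> all non-negative representatives
   of a give the same sum, so the image below is a singleton. *)
definition K0_val :: "'v ggraph \<Rightarrow> ('v \<Rightarrow> ennreal) \<Rightarrow> ('v \<Rightarrow>\<^sub>0 real) set \<Rightarrow> ennreal" where
  "K0_val G \<phi> a =
     the_elem ((\<lambda>x. \<Sum>v\<in>Poly_Mapping.keys x. ennreal (Poly_Mapping.lookup x v) * \<phi> v) `
       (a \<inter> nonneg_combs G))"

definition semifinite :: "'v ggraph \<Rightarrow> ('v \<Rightarrow> ennreal) \<Rightarrow> bool" where
  "semifinite G \<phi> \<longleftrightarrow> \<not> finite_fun G \<phi> \<and>
     (\<forall>a\<in>K0_plus G. K0_val G \<phi> a =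
        (SUP b\<in>{b \<in> K0_plus G. K0_le G b a \<and> K0_val G \<phi> b < \<infinity>}. K0_val G \<phi> b))"

definition indecomposable :: "'v ggraph \<Rightarrow> ('v \<Rightarrow> ennreal) \<Rightarrow> bool" where
  "indecomposable G \<phi> \<longleftrightarrow>
     (\<forall>\<psi>. harmonic G \<psi> \<and> (finite_fun G \<psi> \<or> semifinite G \<psi>) \<and>
        (\<forall>u\<in>verts G. \<psi> u \<le> \<phi> u) \<and> nonvanishing_on (finiteness_ideal G \<phi>) \<psi> \<longrightarrow>
        (\<exists>c::real. 0 \<le> c \<and> (\<forall>u\<in>finiteness_ideal G \<phi>. \<psi> u = ennreal c * \<phi> u)))"

definition Hex :: "'v ggraph \<Rightarrow> ('v \<Rightarrow> ennreal) set" where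
  "Hex G = {\<phi>. harmonic G \<phi> \<and>
     (finite_fun G \<phi> \<and> nonvanishing_on (verts G) \<phi> \<or> semifinite G \<phi>) \<and> indecomposable G \<phi>}"

definition Hex_pos :: "'v ggraph \<Rightarrow> ('v \<Rightarrow> ennreal) set" where
  "Hex_pos G = {\<phi> \<in> Hex G. \<forall>u\<in>verts G. 0 < \<phi> u}"

definition Res :: "'v set \<Rightarrow> ('v \<Rightarrow> ennreal) \<Rightarrow> ('v \<Rightarrow> ennreal)" where
  "Res I \<phi> = restrict \<phi> I"

definition level_sum :: "'v ggraph \<Rightarrow> 'v set \<Rightarrow> ('v \<Rightarrow> ennreal) \<Rightarrow> 'v \<Rightarrow> nat \<Rightarrow> ennreal" where
  "level_sum G I \<phi> u N = (\<Sum>v\<in>{v \<in> I. grade G v = N}. ennreal (gdim G u v) * \<phi> v)"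

definition Ext :: "'v ggraph \<Rightarrow> 'v set \<Rightarrow> ('v \<Rightarrow> ennreal) \<Rightarrow> ('v \<Rightarrow> ennreal)" where
  "Ext G I \<phi> = (\<lambda>u\<in>verts G. lim (level_sum G I \<phi> u))"

end

(* Averaging along edges acts on functions on the vertices.  If a function that is harmonic on an
   ideal J is cut off outside J, its iterated averages increase, and their supremum is the least
   harmonic function extending it (this is Ext).  Pairing a combination x with the vertices of a
   high level N by means of dim turns the relations of K_0 into identities and the order of K_0
   into a coordinatewise comparison; so the supremum over b in the definition of semifiniteness
   becomes a limit over N, and a harmonic function is finite or semifinite exactly when it is the
   extension of its restriction to its own finiteness ideal.  After this reformulation the
   bijection rests on two facts.  If phi is indecomposable then Ext(phi|I) <= phi is
   proportional to phi, with factor 1 by comparison on I.  If psi <= Ext(phi), then at points where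
   Ext(phi) is finite the part of psi outside the finiteness ideal of phi escapes to 0 under
   averaging, so psi is determined there by its values on that ideal. *)

theory Submission
  imports Defs
begin

section \<open>Ideals as successor-closed vertex sets\<close>

text \<open>Closure under one edge propagates along a path by induction on its list. In this form
  the notion is directly compatible with averaging over successors.\<close>

lemma graph_ideal_iff:
  "graph_ideal G J \<longleftrightarrow> J \<subseteq> verts G \<and> (\<forall>u\<in>J. succs G u \<subseteq> J)"
proof
  assume J: "graph_ideal G J"
  then show "J \<subseteq> verts G \<and> (\<forall>u\<in>J. succs G u \<subseteq> J)"
    using edge_above[of G] by (auto simp: graph_ideal_def succs_def edge_def)
next
  assume J: "J \<subseteq> verts G \<and> (\<forall>u\<in>J. succs G u \<subseteq> J)"
  have *: "p \<noteq> [] \<Longrightarrow> successively (edge G) p \<Longrightarrow> hd p \<in> J \<Longrightarrow> last p \<in> J" for p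
  proof (induction p)
    case (Cons x p)
    then show ?case using J
      by (cases p) (auto simp: succs_def subset_iff)
  qed simp
  show "graph_ideal G J"
    unfolding graph_ideal_def above_def gpaths_def using J * by auto
qed

lemma graph_ideal_verts: "graph_ideal G (verts G)"
  by (simp add: graph_ideal_def)

lemma verts_subgraph [simp]: "verts (subgraph G I) = I"
  and grade_subgraph [simp]: "grade (subgraph G I) = grade G"
  and kap_subgraph [simp]: "kap (subgraph G I) = kap G"
  and subgraph_verts [simp]: "subgraph G (verts G) = G"
  by (simp_all add: subgraph_def)

lemma succs_subset_verts: "succs G u \<subseteq> verts G"
  by (auto simp: succs_def edge_def)

lemma grade_succs: "v \<in> succs G u \<Longrightarrow> grade G v = Suc (grade G u)"
  by (auto simp: succs_def edge_def)

lemma succs_subgraph: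
  assumes "graph_ideal G I" "u \<in> I"
  shows "succs (subgraph G I) u = succs G u"
proof -
  have "I \<subseteq> verts G" "succs G u \<subseteq> I" using assms by (auto simp: graph_ideal_iff)
  then show ?thesis using assms(2) by (auto simp: succs_def edge_def)
qed

lemma finite_succs:
  assumes "graded_graph G"
  shows "finite (succs G u)"
  by (rule finite_subset[of _ "level G (grade G u + 1)"])
    (use assms in \<open>auto simp: graded_graph_def succs_def edge_def level_def\<close>)

lemma kap_succs_pos:
  assumes "graded_graph G" "v \<in> succs G u"
  shows "0 < kap G u v"
  using assms by (auto simp: graded_graph_def succs_def edge_def less_le)


section \<open>Paths\<close>

lemma gpaths_step:
  assumes "u \<in> verts G" "u \<noteq> v"
  shows "gpaths G u v = (\<Union>w\<in>succs G u. Cons u ` gpaths G w v)"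
proof (intro set_eqI iffI)
  fix p assume p: "p \<in> gpaths G u v"
  then obtain q where q: "p = u # q" by (cases p) (auto simp: gpaths_def)
  with p assms have "q \<noteq> []" by (auto simp: gpaths_def)
  then obtain w r where r: "q = w # r" by (cases q) auto
  have "w \<in> succs G u" "q \<in> gpaths G w v"
    using p q r by (auto simp: gpaths_def succs_def)
  then show "p \<in> (\<Union>w\<in>succs G u. Cons u ` gpaths G w v)" using q by auto
next
  fix p assume "p \<in> (\<Union>w\<in>succs G u. Cons u ` gpaths G w v)"
  then obtain w q where "w \<in> succs G u" "q \<in> gpaths G w v" "p = u # q" by auto
  then show "p \<in> gpaths G u v" using assms
    by (cases q) (auto simp: gpaths_def succs_def)
qed

lemma gpaths_length:
  assumes "p \<in> gpaths G u v"
  shows "grade G v = grade G u + (length p - 1)"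
proof -
  have "p \<noteq> [] \<Longrightarrow> successively (edge G) p \<Longrightarrow> grade G (last p) = grade G (hd p) + (length p - 1)"
  proof (induction p)
    case (Cons x p)
    then show ?case by (cases p) (auto simp: edge_def)
  qed simp
  then show ?thesis using assms by (auto simp: gpaths_def)
qed

lemma gpaths_self:
  assumes "u \<in> verts G"
  shows "gpaths G u u = {[u]}"
proof (intro set_eqI iffI)
  fix p assume p: "p \<in> gpaths G u u"
  then have "length p - 1 = 0" "p \<noteq> []" using gpaths_length[OF p] by (auto simp: gpaths_def)
  then obtain x where "p = [x]" by (cases p) auto
  then show "p \<in> {[u]}" using p by (auto simp: gpaths_def)
qed (use assms in \<open>auto simp: gpaths_def\<close>)

lemma gpaths_empty:
  assumes "u \<noteq> v" "grade G v \<le> grade G u"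
  shows "gpaths G u v = {}"
proof (rule equals0I)
  fix p assume p: "p \<in> gpaths G u v"
  then have "length p - 1 = 0" "p \<noteq> []"
    using gpaths_length[OF p] assms by (auto simp: gpaths_def)
  then obtain x where "p = [x]" by (cases p) auto
  then show False using p assms by (auto simp: gpaths_def)
qed

lemma finite_gpaths:
  assumes "graded_graph G" "u \<in> verts G"
  shows "finite (gpaths G u v)"
  using assms(2)
\<comment> \<open>The difference is truncated, so it drops along an edge only while the grade of
  \<open>u\<close> is below that of \<open>v\<close>; the other case is settled directly.\<close>
proof (induction "grade G v - grade G u" arbitrary: u rule: less_induct)
  case less
  show ?case
  proof (cases "u = v \<or> grade G v \<le> grade G u")
    case True
    then show ?thesis using less.prems by (cases "u = v") (simp_all add: gpaths_self gpaths_empty)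
  next
    case False
    have "finite (gpaths G w v)" if "w \<in> succs G u" for w
      by (rule less.hyps) (use that False succs_subset_verts[of G u] in \<open>auto simp: grade_succs\<close>)
    then show ?thesis
      using False less.prems finite_succs[OF assms(1)] by (subst gpaths_step) auto
  qed
qed

lemma path_weight_Cons:
  "p \<noteq> [] \<Longrightarrow> path_weight G (u # p) = kap G u (hd p) * path_weight G p"
  unfolding path_weight_def
  by (cases p) (simp_all add: prod.lessThan_Suc_shift del: prod.lessThan_Suc)

lemma gdim_self: "u \<in> verts G \<Longrightarrow> gdim G u u = 1"
  by (simp add: gdim_def gpaths_self path_weight_def)

lemma gdim_eq_0: "u \<noteq> v \<Longrightarrow> grade G v \<le> grade G u \<Longrightarrow> gdim G u v = 0"
  by (simp add: gdim_def gpaths_empty)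

text \<open>Paths are sorted by their first edge; the classes are disjoint because the second
  vertices differ. A recursion in the lower vertex is the one that matches averaging over
  successors.\<close>

lemma gdim_step:
  assumes "graded_graph G" "u \<in> verts G" "u \<noteq> v"
  shows "gdim G u v = (\<Sum>w\<in>succs G u. kap G u w * gdim G w v)"
proof -
  have fin: "finite (gpaths G w v)" if "w \<in> succs G u" for w
    using finite_gpaths[OF assms(1)] that succs_subset_verts[of G u] by blast
  have "gdim G u v = (\<Sum>w\<in>succs G u. \<Sum>p\<in>Cons u ` gpaths G w v. path_weight G p)"
    unfolding gdim_def gpaths_step[OF assms(2,3)]
    by (rule sum.UNION_disjoint) (use fin finite_succs[OF assms(1)] in \<open>auto simp: gpaths_def\<close>)
  also have "\<dots> = (\<Sum>w\<in>succs G u. kap G u w * gdim G w v)"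
  proof (rule sum.cong[OF refl])
    fix w
    have "(\<Sum>p\<in>Cons u ` gpaths G w v. path_weight G p) = (\<Sum>p\<in>gpaths G w v. path_weight G (u # p))"
      by (rule sum.reindex_cong[of "Cons u"]) auto
    also have "\<dots> = (\<Sum>p\<in>gpaths G w v. kap G u w * path_weight G p)"
      by (rule sum.cong) (auto simp: path_weight_Cons gpaths_def)
    finally show "(\<Sum>p\<in>Cons u ` gpaths G w v. path_weight G p) = kap G u w * gdim G w v"
      by (simp add: gdim_def sum_distrib_left)
  qed
  finally show ?thesis .
qed

lemma gdim_nonneg:
  assumes "graded_graph G"
  shows "0 \<le> gdim G u v"
  unfolding gdim_def path_weight_def
proof (intro sum_nonneg prod_nonneg)
  fix p i assume "p \<in> gpaths G u v" "i \<in> {..<length p - 1}"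
  then have "p ! i \<in> verts G" "p ! Suc i \<in> verts G"
    by (auto simp: gpaths_def)
  then show "0 \<le> kap G (p ! i) (p ! Suc i)" using assms by (auto simp: graded_graph_def)
qed


section \<open>Extension by iterated averaging\<close>

text \<open>The averaging operator whose fixed points are the harmonic functions. Away from
  \<open>verts G\<close> there are no successors and the value is 0.\<close>

definition step :: "'v ggraph \<Rightarrow> ('v \<Rightarrow> ennreal) \<Rightarrow> 'v \<Rightarrow> ennreal" where
  "step G f u = (\<Sum>v\<in>succs G u. ennreal (kap G u v) * f v)"

definition cutoff :: "'v set \<Rightarrow> ('v \<Rightarrow> ennreal) \<Rightarrow> 'v \<Rightarrow> ennreal" where
  "cutoff J f u = (if u \<in> J then f u else 0)"

text \<open>A supremum in place of a limit, so that bounds can be proved iterate by iterate for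
  every \<open>f\<close>. For an ideal \<open>J\<close> and \<open>f\<close> harmonic on it the
  iterates increase and both agree.\<close>

definition lift :: "'v ggraph \<Rightarrow> 'v set \<Rightarrow> ('v \<Rightarrow> ennreal) \<Rightarrow> 'v \<Rightarrow> ennreal" where
  "lift G J f u = (SUP n. (step G ^^ n) (cutoff J f) u)"

text \<open>Keeps the ambient graph and drops extensionality, so that functions living on different
  ideals can be compared inside one graph.\<close>

definition harmonic_on :: "'v ggraph \<Rightarrow> 'v set \<Rightarrow> ('v \<Rightarrow> ennreal) \<Rightarrow> bool" where
  "harmonic_on G J f \<longleftrightarrow> (\<forall>u\<in>J. f u = step G f u)"

lemma harmonic_subgraph_iff:
  assumes "graph_ideal G I"
  shows "harmonic (subgraph G I) f \<longleftrightarrow> f \<in> extensional I \<and> harmonic_on G I f"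
  unfolding harmonic_def harmonic_on_def step_def using succs_subgraph[OF assms] by simp

lemma harmonic_iff: "harmonic G f \<longleftrightarrow> f \<in> extensional (verts G) \<and> harmonic_on G (verts G) f"
  using harmonic_subgraph_iff[OF graph_ideal_verts] by simp

lemma harmonic_on_subset: "harmonic_on G J f \<Longrightarrow> J' \<subseteq> J \<Longrightarrow> harmonic_on G J' f"
  by (auto simp: harmonic_on_def)

lemma mono_step: "mono (step G)"
  by (auto intro!: monoI le_funI sum_mono mult_left_mono simp: step_def le_fun_def)

lemma step_cong: "(\<And>v. v \<in> succs G u \<Longrightarrow> f v = g v) \<Longrightarrow> step G f u = step G g u"
  by (simp add: step_def)

lemma funpow_step_mono: "(\<And>v. f v \<le> g v) \<Longrightarrow> (step G ^^ n) f u \<le> (step G ^^ n) g u"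
  using funpow_mono[OF mono_step[of G] le_funI[of f g], of n] by (auto simp: le_fun_def)

text \<open>The iterates at a vertex of an ideal look only at vertices reachable from it, and these
  stay in the ideal.\<close>

lemma funpow_step_cong:
  assumes "graph_ideal G J" "\<And>v. v \<in> J \<Longrightarrow> f v = g v" "u \<in> J"
  shows "(step G ^^ n) f u = (step G ^^ n) g u"
  using assms(3)
proof (induction n arbitrary: u)
  case (Suc n)
  have "succs G u \<subseteq> J" using assms(1) Suc.prems by (auto simp: graph_ideal_iff)
  then show ?case using Suc.IH by (auto intro!: step_cong)
qed (simp add: assms)

lemma funpow_step_subgraph:
  assumes "graph_ideal G I" "u \<in> I"
  shows "(step (subgraph G I) ^^ n) f u = (step G ^^ n) f u"
  using assms(2)
proof (induction n arbitrary: u)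
  case (Suc n)
  have "succs G u \<subseteq> I" using assms(1) Suc.prems by (auto simp: graph_ideal_iff)
  moreover have "step (subgraph G I) g u = step G g u" for g
    using succs_subgraph[OF assms(1) Suc.prems] by (simp add: step_def)
  ultimately show ?case using Suc.IH by (auto intro!: step_cong)
qed simp

lemma lift_subgraph:
  "graph_ideal G I \<Longrightarrow> u \<in> I \<Longrightarrow> lift (subgraph G I) J f u = lift G J f u"
  by (simp add: lift_def funpow_step_subgraph)

lemma funpow_step_add:
  "(step G ^^ n) (\<lambda>v. f v + g v) u = (step G ^^ n) f u + (step G ^^ n) g u"
proof (induction n arbitrary: u)
  case (Suc n)
  then show ?case by (simp add: step_def distrib_left sum.distrib)
qed simp

lemma funpow_step_cmult:
  "(step G ^^ n) (\<lambda>v. c * f v) u = c * (step G ^^ n) f u"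
proof (induction n arbitrary: u)
  case (Suc n)
  then show ?case by (simp add: step_def sum_distrib_left mult.left_commute)
qed simp

lemma funpow_step_harmonic_on:
  assumes "graph_ideal G J" "harmonic_on G J f" "u \<in> J"
  shows "(step G ^^ n) f u = f u"
  using assms(3)
proof (induction n arbitrary: u)
  case (Suc n)
  have "succs G u \<subseteq> J" using assms(1) Suc.prems by (auto simp: graph_ideal_iff)
  then have "(step G ^^ Suc n) f u = step G f u"
    using Suc.IH by (auto intro!: step_cong)
  then show ?case using assms(2) Suc.prems by (simp add: harmonic_on_def)
qed simp

lemma funpow_step_cut:
  assumes "graph_ideal G J" "harmonic_on G J f" "u \<in> J"
  shows "(step G ^^ n) (cutoff J f) u = f u"
  using funpow_step_cong[OF assms(1), of "cutoff J f" f u n] funpow_step_harmonic_on[OF assms] assms(3)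
  by (simp add: cutoff_def)

lemma lift_eq:
  assumes "graph_ideal G J" "harmonic_on G J f" "u \<in> J"
  shows "lift G J f u = f u"
  by (simp add: lift_def funpow_step_cut[OF assms])

text \<open>The cutoff is bounded by its own average: on \<open>J\<close> the two agree by
  harmonicity, elsewhere the cutoff is 0. Monotonicity of \<open>step\<close> carries this
  inequality to all iterates.\<close>

lemma incseq_funpow_step_cut:
  assumes "graph_ideal G J" "harmonic_on G J f"
  shows "incseq (\<lambda>n. (step G ^^ n) (cutoff J f) u)"
proof (rule incseq_SucI)
  fix n
  have "cutoff J f v \<le> step G (cutoff J f) v" for v
    using funpow_step_cut[OF assms, of v 1] by (cases "v \<in> J") (auto simp: cutoff_def)
  then show "(step G ^^ n) (cutoff J f) u \<le> (step G ^^ Suc n) (cutoff J f) u"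
    unfolding funpow_Suc_right by (simp add: funpow_step_mono)
qed

text \<open>Monotone convergence: the iterates increase, so averaging commutes with their supremum
  and only shifts the index by one, which leaves the supremum unchanged.\<close>

lemma step_lift:
  assumes "graph_ideal G J" "harmonic_on G J f"
  shows "step G (lift G J f) u = lift G J f u"
proof -
  let ?s = "\<lambda>n v. (step G ^^ n) (cutoff J f) v"
  have inc: "incseq (\<lambda>n. ?s n u)" for u by (rule incseq_funpow_step_cut[OF assms])
  have inc': "incseq (\<lambda>n. ennreal (kap G u v) * ?s n v)" for v
    using inc[of v] by (auto simp: incseq_def intro: mult_left_mono)
  have "step G (lift G J f) u = (SUP n. ?s (Suc n) u)"
    by (simp add: step_def lift_def SUP_mult_left_ennreal ennreal_SUP_sum[OF inc'])
  also have "\<dots> = (SUP n. ?s n u)"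
    by (intro antisym SUP_mono) (use inc[of u] in \<open>auto simp del: funpow.simps intro: incseq_SucD\<close>)
  finally show ?thesis by (simp add: lift_def)
qed

lemma harmonic_on_lift:
  "graph_ideal G J \<Longrightarrow> harmonic_on G J f \<Longrightarrow> harmonic_on G A (lift G J f)"
  by (simp add: harmonic_on_def step_lift)

lemma lift_mono:
  assumes "J \<subseteq> J'" "\<And>v. v \<in> J \<Longrightarrow> f v \<le> g v"
  shows "lift G J f u \<le> lift G J' g u"
  unfolding lift_def
  by (intro SUP_mono' funpow_step_mono) (use assms in \<open>auto simp: cutoff_def\<close>)

lemma lift_cong: "(\<And>v. v \<in> J \<Longrightarrow> f v = g v) \<Longrightarrow> lift G J f u = lift G J g u"
  by (rule antisym; rule lift_mono) auto

text \<open>Minimality of the extension. From \<open>u\<close> only the part of \<open>J\<close> in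
  \<open>I\<close> is visible, there \<open>f\<close> lies below \<open>g\<close>, and averaging
  reproduces \<open>g\<close> on \<open>I\<close>.\<close>

lemma lift_le:
  assumes "graph_ideal G I" "harmonic_on G I g" "u \<in> I"
    and "\<And>v. v \<in> J \<inter> I \<Longrightarrow> f v \<le> g v"
  shows "lift G J f u \<le> g u"
  unfolding lift_def
proof (rule SUP_least)
  fix n
  have "(step G ^^ n) (cutoff J f) u = (step G ^^ n) (cutoff (J \<inter> I) f) u"
    by (rule funpow_step_cong[OF assms(1) _ assms(3)]) (simp add: cutoff_def)
  also have "\<dots> \<le> (step G ^^ n) (cutoff I g) u"
    by (rule funpow_step_mono) (use assms(4) in \<open>auto simp: cutoff_def\<close>)
  also have "\<dots> = g u" by (rule funpow_step_cut[OF assms(1-3)])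
  finally show "(step G ^^ n) (cutoff J f) u \<le> g u" .
qed

lemma lift_Int:
  assumes "graph_ideal G I" "u \<in> I"
  shows "lift G (J \<inter> I) f u = lift G J f u"
  unfolding lift_def
  by (intro SUP_cong refl funpow_step_cong[OF assms(1) _ assms(2)]) (simp add: cutoff_def)

lemma lift_cmult:
  assumes "\<And>v. v \<in> J \<Longrightarrow> f v = c * g v"
  shows "lift G J f u = c * lift G J g u"
proof -
  have "cutoff J f = (\<lambda>v. c * cutoff J g v)" using assms by (auto simp: cutoff_def)
  then show ?thesis by (simp add: lift_def funpow_step_cmult SUP_mult_left_ennreal)
qed

text \<open>The mass of \<open>\<Phi>\<close> outside \<open>J\<close> escapes to 0 along the iteration, hence so does that of \<open>\<psi>\<close>.\<close>

lemma lift_dominated: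
  assumes J: "graph_ideal G J"
    and \<psi>: "harmonic_on G (verts G) \<psi>" and \<Phi>: "harmonic_on G (verts G) \<Phi>"
    and le: "\<And>v. v \<in> verts G \<Longrightarrow> \<psi> v \<le> \<Phi> v"
    and u: "u \<in> verts G" "\<Phi> u < \<infinity>" "lift G J \<Phi> u = \<Phi> u"
  shows "lift G J \<psi> u = \<psi> u"
proof (rule antisym)
  have JG: "J \<subseteq> verts G" using J by (simp add: graph_ideal_def)
  show "lift G J \<psi> u \<le> \<psi> u"
    by (rule lift_le[OF graph_ideal_verts \<psi> u(1)]) simp
  let ?a = "\<lambda>f n. (step G ^^ n) (cutoff J f) u"
  let ?d = "\<lambda>f n. (step G ^^ n) (cutoff (verts G - J) f) u"
  have split: "f u = ?a f n + ?d f n" if "harmonic_on G (verts G) f" for f n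
  proof -
    have "cutoff (verts G) f = (\<lambda>v. cutoff J f v + cutoff (verts G - J) f v)"
      using JG by (auto simp: cutoff_def fun_eq_iff)
    then show ?thesis
      using funpow_step_cut[OF graph_ideal_verts that u(1), of n] by (simp add: funpow_step_add)
  qed
  \<comment> \<open>The comparison of the escaping masses, rearranged to avoid subtraction in
    \<open>ennreal\<close>; the finite value of \<open>\<Phi>\<close> at \<open>u\<close> is
    cancelled at the very end.\<close>
  have "\<psi> u + ?a \<Phi> n \<le> lift G J \<psi> u + \<Phi> u" for n
  proof -
    have "?d \<psi> n \<le> ?d \<Phi> n"
      by (rule funpow_step_mono) (use le in \<open>auto simp: cutoff_def\<close>)
    moreover have "?a \<psi> n \<le> lift G J \<psi> u" unfolding lift_def by (rule SUP_upper) simp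
    ultimately have "\<psi> u + ?a \<Phi> n \<le> (lift G J \<psi> u + ?d \<Phi> n) + ?a \<Phi> n"
      using split[OF \<psi>, of n] by (simp add: add_mono)
    also have "\<dots> = lift G J \<psi> u + \<Phi> u"
      using split[OF \<Phi>, of n] by (simp add: add_ac)
    finally show ?thesis .
  qed
  then have "(SUP n. \<psi> u + ?a \<Phi> n) \<le> lift G J \<psi> u + \<Phi> u" by (rule SUP_least)
  then have "\<psi> u + lift G J \<Phi> u \<le> lift G J \<psi> u + \<Phi> u"
    by (simp add: lift_def ennreal_SUP_add_right)
  then show "\<psi> u \<le> lift G J \<psi> u" using u
    by (auto simp: add.commute ennreal_add_left_cancel_le)
qed

section \<open>Level sums and the limit formula for the extension\<close>

text \<open>Averaging \<open>n\<close> times runs through the paths of \<open>n\<close> edges from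
  \<open>u\<close>, which end at grade \<open>grade G u + n\<close>. Moving to a successor uses up
  one edge and raises the grade by one, so the level stays fixed in the induction.\<close>

lemma level_sum_add:
  assumes gg: "graded_graph G" and J: "graph_ideal G J" and "u \<in> verts G"
  shows "level_sum G J f u (grade G u + n) = (step G ^^ n) (cutoff J f) u"
  using assms(3)
proof (induction n arbitrary: u)
  case 0
  have "finite {v \<in> J. grade G v = grade G u}"
    by (rule finite_subset[of _ "level G (grade G u)"])
      (use gg J in \<open>auto simp: graded_graph_def level_def graph_ideal_def\<close>)
  moreover have "ennreal (gdim G u v) * f v = (if u = v then f v else 0)"
    if "v \<in> {v \<in> J. grade G v = grade G u}" for v
    using that 0 by (auto simp: gdim_self gdim_eq_0)
  ultimately show ?case by (simp add: level_sum_def cutoff_def)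
next
  case (Suc n)
  let ?L = "{v \<in> J. grade G v = grade G u + Suc n}"
  have "ennreal (gdim G u v) * f v
      = (\<Sum>w\<in>succs G u. ennreal (kap G u w) * (ennreal (gdim G w v) * f v))" if "v \<in> ?L" for v
  proof -
    have "u \<noteq> v" using that by auto
    have "ennreal (gdim G u v) = (\<Sum>w\<in>succs G u. ennreal (kap G u w * gdim G w v))"
      unfolding gdim_step[OF gg Suc.prems \<open>u \<noteq> v\<close>]
      by (rule sum_ennreal[symmetric])
        (use kap_succs_pos[OF gg] gdim_nonneg[OF gg] in \<open>simp add: less_imp_le\<close>)
    also have "\<dots> = (\<Sum>w\<in>succs G u. ennreal (kap G u w) * ennreal (gdim G w v))"
      using kap_succs_pos[OF gg] gdim_nonneg[OF gg] by (simp add: ennreal_mult less_imp_le)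
    finally show ?thesis by (simp add: sum_distrib_right mult.assoc)
  qed
  then have "level_sum G J f u (grade G u + Suc n)
      = (\<Sum>v\<in>?L. \<Sum>w\<in>succs G u. ennreal (kap G u w) * (ennreal (gdim G w v) * f v))"
    by (simp add: level_sum_def)
  also have "\<dots> = (\<Sum>w\<in>succs G u. ennreal (kap G u w) * level_sum G J f w (grade G w + n))"
    unfolding level_sum_def sum_distrib_left
    by (subst sum.swap) (simp add: grade_succs)
  also have "\<dots> = (step G ^^ Suc n) (cutoff J f) u"
    using Suc.IH succs_subset_verts[of G u] by (auto simp: step_def[of G "(step G ^^ n) _"] intro!: sum.cong)
  finally show ?case .
qed

lemma level_sum_LIMSEQ:
  assumes "graded_graph G" "graph_ideal G J" "harmonic_on G J f" "u \<in> verts G"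
  shows "level_sum G J f u \<longlonglongrightarrow> lift G J f u"
proof (rule LIMSEQ_offset[of _ "grade G u"])
  show "(\<lambda>n. level_sum G J f u (n + grade G u)) \<longlonglongrightarrow> lift G J f u"
    using LIMSEQ_SUP[OF incseq_funpow_step_cut[OF assms(2,3), of u]]
    by (simp add: level_sum_add[OF assms(1,2,4)] add.commute[of _ "grade G u"] lift_def)
qed

text \<open>Levels below \<open>u\<close>, where the sum vanishes, are included so that one
  \<open>N\<close> can serve for a combination of vertices of different grades.\<close>

lemma level_sum_le_lift:
  assumes "graded_graph G" "graph_ideal G J" "u \<in> verts G"
  shows "level_sum G J f u N \<le> lift G J f u"
proof (cases "grade G u \<le> N")
  case True
  then obtain n where "N = grade G u + n" by (auto simp: le_iff_add)
  then show ?thesis by (auto simp: level_sum_add[OF assms] lift_def intro: SUP_upper)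
next
  case False
  then have "level_sum G J f u N = 0"
    unfolding level_sum_def by (intro sum.neutral ballI, subst gdim_eq_0) (use False in auto)
  then show ?thesis by simp
qed

lemma Ext_eq_lift:
  assumes "graded_graph G" "graph_ideal G J" "harmonic_on G J f"
  shows "Ext G J f = restrict (lift G J f) (verts G)"
  unfolding Ext_def
  by (rule restrict_ext) (use level_sum_LIMSEQ[OF assms] in \<open>simp add: limI\<close>)


section \<open>The group \<open>K\<^sub>0\<close>\<close>

text \<open>The linear extension of u \<mapsto> dim(u, v). It annihilates the relators of all
  vertices other than \<open>v\<close>, so a given relation of K_0 is invisible to it once
  \<open>v\<close> is high enough.\<close>

definition pair :: "'v ggraph \<Rightarrow> 'v \<Rightarrow> ('v \<Rightarrow>\<^sub>0 real) \<Rightarrow> real" where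
  "pair G v x = (\<Sum>u\<in>Poly_Mapping.keys x. Poly_Mapping.lookup x u * gdim G u v)"

definition eval_comb :: "('v \<Rightarrow> ennreal) \<Rightarrow> ('v \<Rightarrow>\<^sub>0 real) \<Rightarrow> ennreal" where
  "eval_comb f x = (\<Sum>u\<in>Poly_Mapping.keys x. ennreal (Poly_Mapping.lookup x u) * f u)"

text \<open>Vertices are replaced by their expansions on \<open>S\<close>, with dimensions as
  coefficients. If \<open>S\<close> is a full level not below the support, the class in K_0 is
  unchanged.\<close>

definition push :: "'v ggraph \<Rightarrow> 'v set \<Rightarrow> ('v \<Rightarrow>\<^sub>0 real) \<Rightarrow> ('v \<Rightarrow>\<^sub>0 real)" where
  "push G S x = (\<Sum>v\<in>S. Poly_Mapping.single v (pair G v x))"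

lemma lookup_scaleR:
  fixes x :: "'a \<Rightarrow>\<^sub>0 real"
  shows "Poly_Mapping.lookup (r *\<^sub>R x) i = r * Poly_Mapping.lookup x i"
  by (simp add: scaleR_poly_mapping_def)

lemma scaleR_single: "r *\<^sub>R Poly_Mapping.single v c = Poly_Mapping.single v (r * c :: real)"
  by (rule poly_mapping_eqI) (simp add: lookup_scaleR lookup_single when_def)

lemma keys_scaleR_subset:
  fixes x :: "'a \<Rightarrow>\<^sub>0 real"
  shows "Poly_Mapping.keys (r *\<^sub>R x) \<subseteq> Poly_Mapping.keys x"
  by (auto simp: in_keys_iff lookup_scaleR)

lemma pair_superset:
  assumes "finite S" "Poly_Mapping.keys x \<subseteq> S"
  shows "pair G v x = (\<Sum>u\<in>S. Poly_Mapping.lookup x u * gdim G u v)"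
  unfolding pair_def using assms by (intro sum.mono_neutral_left) (auto simp: in_keys_iff)

lemma eval_comb_superset:
  assumes "finite S" "Poly_Mapping.keys x \<subseteq> S"
  shows "eval_comb f x = (\<Sum>u\<in>S. ennreal (Poly_Mapping.lookup x u) * f u)"
  unfolding eval_comb_def using assms by (intro sum.mono_neutral_left) (auto simp: in_keys_iff)

lemma linear_pair: "linear (pair G (v :: 'v))"
proof (rule linearI)
  fix x y :: "'v \<Rightarrow>\<^sub>0 real"
 
  let ?S = "Poly_Mapping.keys x \<union> Poly_Mapping.keys y"
  have "pair G v (x + y) = (\<Sum>u\<in>?S. Poly_Mapping.lookup (x + y) u * gdim G u v)"
    by (rule pair_superset) (auto simp: in_keys_iff lookup_add)
  also have "\<dots> = pair G v x + pair G v y"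
    using pair_superset[of ?S x G v] pair_superset[of ?S y G v]
    by (simp add: lookup_add distrib_right sum.distrib)
  finally show "pair G v (x + y) = pair G v x + pair G v y" .
next
  fix r and x :: "'v \<Rightarrow>\<^sub>0 real"
 
  have "pair G v (r *\<^sub>R x)
      = (\<Sum>u\<in>Poly_Mapping.keys x. Poly_Mapping.lookup (r *\<^sub>R x) u * gdim G u v)"
    by (rule pair_superset) (simp_all add: keys_scaleR_subset)
  then show "pair G v (r *\<^sub>R x) = r *\<^sub>R pair G v x"
    by (simp add: pair_def lookup_scaleR sum_distrib_left mult.assoc)
qed

lemma pair_single: "pair G v (Poly_Mapping.single u c) = c * gdim G u v"
  by (subst pair_superset[of "{u}"]) simp_all

lemma linear_push: "linear (push G (S :: 'v set))"
proof (rule linearI)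
  fix x y :: "'v \<Rightarrow>\<^sub>0 real"
  show "push G S (x + y) = push G S x + push G S y"
    by (simp add: push_def linear_add[OF linear_pair] single_add sum.distrib)
next
  fix r and x :: "'v \<Rightarrow>\<^sub>0 real"
  show "push G S (r *\<^sub>R x) = r *\<^sub>R push G S x"
    by (simp add: push_def linear_cmul[OF linear_pair] scaleR_sum_right scaleR_single)
qed

lemma pair_relator:
  assumes "graded_graph G" "u \<in> verts G" "u \<noteq> v"
  shows "pair G v (relator G u) = 0"
  using gdim_step[OF assms]
  by (simp add: relator_def linear_diff[OF linear_pair] linear_sum[OF linear_pair] pair_single)

text \<open>An element of the span involves finitely many relators, and a bound for the grades of
  their vertices serves as \<open>M\<close>.\<close>

lemma pair_span_relators:
  assumes "graded_graph G" "z \<in> span (relator G ` verts G)"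
  shows "\<exists>M. \<forall>v. M < grade G v \<longrightarrow> pair G v z = 0"
  using assms(2)
proof (induction rule: span_induct_alt)
  case base
  then show ?case by (simp add: linear_0[OF linear_pair])
next
  case (step c r y)
  then obtain u M where u: "u \<in> verts G" "r = relator G u"
    and M: "\<forall>v. M < grade G v \<longrightarrow> pair G v y = 0" by auto
  have "pair G v (c *\<^sub>R r + y) = 0" if "max M (grade G u) < grade G v" for v
    using that M pair_relator[OF assms(1) u(1), of v]
    by (auto simp: linear_add[OF linear_pair] linear_cmul[OF linear_pair] u)
  then show ?case by blast
qed

lemma subspace_free_space: "subspace (free_space G)"
  unfolding subspace_def free_space_def
  by (auto simp: in_keys_iff lookup_add lookup_scaleR subset_iff) (metis add_0)

lemma equiv_K0_rel: "equiv (free_space G) (K0_rel G)"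
proof (rule equivI)
  show "K0_rel G \<subseteq> free_space G \<times> free_space G" by (auto simp: K0_rel_def)
  show "refl_on (free_space G) (K0_rel G)"
    by (auto simp: refl_on_def K0_rel_def span_zero)
  show "sym (K0_rel G)"
    by (auto simp: sym_def K0_rel_def) (metis minus_diff_eq span_neg)
  show "trans (K0_rel G)"
    by (auto simp: trans_def K0_rel_def) (metis (no_types, lifting) diff_add_cancel add_diff_eq span_add)
qed

lemma nonneg_combs_subset: "nonneg_combs G \<subseteq> free_space G"
  by (auto simp: nonneg_combs_def)

lemma K0_plus_iff: "a \<in> K0_plus G \<longleftrightarrow> (\<exists>x\<in>nonneg_combs G. a = K0_rel G `` {x})"
proof
  assume "a \<in> K0_plus G"
  then obtain y x where "y \<in> free_space G" "a = K0_rel G `` {y}" "x \<in> a" "x \<in> nonneg_combs G"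
    by (auto simp: K0_plus_def K0_def quotient_def)
  then show "\<exists>x\<in>nonneg_combs G. a = K0_rel G `` {x}"
    using equiv_class_eq[OF equiv_K0_rel] by blast
next
  assume "\<exists>x\<in>nonneg_combs G. a = K0_rel G `` {x}"
  then obtain x where x: "x \<in> nonneg_combs G" "a = K0_rel G `` {x}" by blast
  then have "x \<in> a" using nonneg_combs_subset equiv_class_self[OF equiv_K0_rel] by blast
  then show "a \<in> K0_plus G"
    using x nonneg_combs_subset by (auto simp: K0_plus_def K0_def quotient_def)
qed

lemma K0_diff_classes:
  assumes "x \<in> free_space G" "y \<in> free_space G"
  shows "K0_diff (K0_rel G `` {x}) (K0_rel G `` {y}) = K0_rel G `` {x - y}"
proof (intro set_eqI iffI)
  fix z assume "z \<in> K0_diff (K0_rel G `` {x}) (K0_rel G `` {y})"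
  then obtain x' y' where "z = x' - y'" "(x, x') \<in> K0_rel G" "(y, y') \<in> K0_rel G"
    by (auto simp: K0_diff_def)
  then have z: "z = x' - y'" "x' \<in> free_space G" "y' \<in> free_space G"
    and "(x - x') - (y - y') \<in> span (relator G ` verts G)"
    by (auto simp: K0_rel_def intro: span_diff)
  moreover have "(x - x') - (y - y') = x - y - (x' - y')" by simp
  ultimately show "z \<in> K0_rel G `` {x - y}"
    using assms by (simp add: K0_rel_def subspace_diff[OF subspace_free_space])
next
  fix z assume "z \<in> K0_rel G `` {x - y}"
  then have "(x, z + y) \<in> K0_rel G" "(y, y) \<in> K0_rel G"
    using assms by (auto simp: K0_rel_def subspace_add[OF subspace_free_space] span_zero algebra_simps)
  moreover have "z = (z + y) - y" by simp
  ultimately show "z \<in> K0_diff (K0_rel G `` {x}) (K0_rel G `` {y})"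
    unfolding K0_diff_def by blast
qed

lemma free_space_subgraph: "I \<subseteq> verts G \<Longrightarrow> free_space (subgraph G I) \<subseteq> free_space G"
  by (auto simp: free_space_def)

text \<open>The successors of a vertex of \<open>I\<close> lie in \<open>I\<close>, so its relator
  is the same in both graphs. This makes the natural map of K_0 well defined.\<close>

lemma K0_rel_subgraph:
  assumes "graph_ideal G I"
  shows "K0_rel (subgraph G I) \<subseteq> K0_rel G"
proof -
  have I: "I \<subseteq> verts G" using assms by (simp add: graph_ideal_def)
  have "relator (subgraph G I) ` I = relator G ` I"
    by (rule image_cong) (simp_all add: relator_def succs_subgraph[OF assms])
  then have "span (relator (subgraph G I) ` I) \<subseteq> span (relator G ` verts G)"
    using I by (metis image_mono span_mono)
  then show ?thesis using free_space_subgraph[OF I] by (auto simp: K0_rel_def)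
qed

lemma K0_incl_class:
  assumes "graph_ideal G I" "y \<in> free_space (subgraph G I)"
  shows "K0_incl G (K0_rel (subgraph G I) `` {y}) = K0_rel G `` {y}"
proof -
  have "(y, y) \<in> K0_rel (subgraph G I)"
    using assms(2) by (simp add: K0_rel_def span_zero)
  moreover have "trans (K0_rel G)" using equiv_K0_rel[of G] by (simp add: equiv_def)
  ultimately show ?thesis
    using K0_rel_subgraph[OF assms(1)] by (auto simp: K0_incl_def dest: transD)
qed

lemma K0_le_classes:
  assumes "x \<in> free_space G" "y \<in> free_space G"
  shows "K0_le G (K0_rel G `` {y}) (K0_rel G `` {x})
    \<longleftrightarrow> (\<exists>z\<in>nonneg_combs G. x - y - z \<in> span (relator G ` verts G))"
proof -
  have "K0_rel G `` {x - y} = K0_rel G `` {z} \<longleftrightarrow> x - y - z \<in> span (relator G ` verts G)"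
    if "z \<in> nonneg_combs G" for z
    using eq_equiv_class_iff[OF equiv_K0_rel, of "x - y" G z] that nonneg_combs_subset[of G]
      subspace_diff[OF subspace_free_space assms] by (auto simp: K0_rel_def)
  then show ?thesis
    unfolding K0_le_def K0_diff_classes[OF assms] K0_plus_iff by blast
qed

section \<open>Values of harmonic functions on classes\<close>

lemma pair_nonneg:
  assumes "graded_graph G" "x \<in> nonneg_combs G"
  shows "0 \<le> pair G v x"
  unfolding pair_def using assms gdim_nonneg[OF assms(1)] by (auto simp: nonneg_combs_def intro!: sum_nonneg)

lemma finite_ideal_level:
  assumes "graded_graph G" "graph_ideal G J"
  shows "finite {v \<in> J. grade G v = N}"
  by (rule finite_subset[of _ "level G N"])
    (use assms in \<open>auto simp: graded_graph_def level_def graph_ideal_def\<close>)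

lemma sum_pair_level:
  assumes "graded_graph G" "x \<in> nonneg_combs G"
  shows "(\<Sum>v\<in>{v \<in> J. grade G v = N}. ennreal (pair G v x) * f v)
    = eval_comb (\<lambda>u. level_sum G J f u N) x"
proof -
  have "ennreal (pair G v x)
      = (\<Sum>u\<in>Poly_Mapping.keys x. ennreal (Poly_Mapping.lookup x u) * ennreal (gdim G u v))" for v
    unfolding pair_def using assms gdim_nonneg[OF assms(1)]
    by (simp add: nonneg_combs_def flip: ennreal_mult)
  then show ?thesis
    unfolding eval_comb_def level_sum_def sum_distrib_left
    by (simp add: sum_distrib_right mult.assoc) (rule sum.swap)
qed

text \<open>Harmonicity on \<open>J\<close> lets each vertex of the support be replaced by its
  expansion at any level not below it, without changing the value.\<close>

lemma eval_comb_eq_sum_pair: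
  assumes gg: "graded_graph G" and J: "graph_ideal G J" and f: "harmonic_on G J f"
    and x: "x \<in> nonneg_combs G" "Poly_Mapping.keys x \<subseteq> J"
  shows "\<exists>M. \<forall>N\<ge>M. eval_comb f x = (\<Sum>v\<in>{v \<in> J. grade G v = N}. ennreal (pair G v x) * f v)"
proof (intro exI allI impI)
  \<comment> \<open>For \<open>x = 0\<close> the maximum is over the empty set and unspecified; this
    is harmless, because there is no vertex to check.\<close>
  fix N assume N: "Max (grade G ` Poly_Mapping.keys x) \<le> N"
  have "level_sum G J f u N = f u" if "u \<in> Poly_Mapping.keys x" for u
  proof -
    have u: "u \<in> J" "u \<in> verts G" using that x J by (auto simp: graph_ideal_def)
    have "grade G u \<le> Max (grade G ` Poly_Mapping.keys x)" using that by (intro Max_ge) auto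
    with N obtain n where n: "N = grade G u + n" by (metis le_iff_add le_trans)
    show ?thesis unfolding n level_sum_add[OF gg J u(2)] by (rule funpow_step_cut[OF J f u(1)])
  qed
  then show "eval_comb f x = (\<Sum>v\<in>{v \<in> J. grade G v = N}. ennreal (pair G v x) * f v)"
    unfolding sum_pair_level[OF gg x(1)] by (simp add: eval_comb_def)
qed

text \<open>On high levels \<open>pair\<close> does not distinguish equivalent combinations, and the
  value is determined by these pairings. This makes \<open>K0_val\<close> independent of the
  representative.\<close>

lemma eval_comb_K0_rel:
  assumes gg: "graded_graph G" and f: "harmonic_on G (verts G) f"
    and xy: "x \<in> nonneg_combs G" "y \<in> nonneg_combs G" "(x, y) \<in> K0_rel G"
  shows "eval_comb f x = eval_comb f y"
proof -
  have k: "Poly_Mapping.keys x \<subseteq> verts G" "Poly_Mapping.keys y \<subseteq> verts G"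
    using xy by (auto simp: nonneg_combs_def free_space_def)
  obtain M where M: "\<And>v. M < grade G v \<Longrightarrow> pair G v (x - y) = 0"
    using pair_span_relators[OF gg, of "x - y"] xy(3) by (auto simp: K0_rel_def)
  obtain M1 M2 where
    M1: "\<And>N. N \<ge> M1 \<Longrightarrow> eval_comb f x = (\<Sum>v\<in>{v \<in> verts G. grade G v = N}. ennreal (pair G v x) * f v)"
    and M2: "\<And>N. N \<ge> M2 \<Longrightarrow> eval_comb f y = (\<Sum>v\<in>{v \<in> verts G. grade G v = N}. ennreal (pair G v y) * f v)"
    using eval_comb_eq_sum_pair[OF gg graph_ideal_verts f xy(1) k(1)]
      eval_comb_eq_sum_pair[OF gg graph_ideal_verts f xy(2) k(2)] by blast
  define N where "N = Suc (M + M1 + M2)"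
  show ?thesis
    using M1[of N] M2[of N] M by (auto simp: N_def linear_diff[OF linear_pair] intro!: sum.cong)
qed

lemma K0_val_class:
  assumes "graded_graph G" "harmonic_on G (verts G) f" "x \<in> nonneg_combs G"
  shows "K0_val G f (K0_rel G `` {x}) = eval_comb f x"
proof -
  let ?A = "K0_rel G `` {x} \<inter> nonneg_combs G"
  have "x \<in> ?A"
    using assms(3) nonneg_combs_subset equiv_class_self[OF equiv_K0_rel] by blast
  then have "(\<lambda>_. eval_comb f x) ` ?A = {eval_comb f x}" by (rule image_constant)
  moreover have "eval_comb f ` ?A = (\<lambda>_. eval_comb f x) ` ?A"
    by (rule image_cong[OF refl]) (simp add: eval_comb_K0_rel[OF assms(1-3), symmetric])
  ultimately have "eval_comb f ` ?A = {eval_comb f x}" by simp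
  then show ?thesis unfolding K0_val_def eval_comb_def[abs_def] by simp
qed

section \<open>Representatives supported on one level\<close>

text \<open>Induction on the distance \<open>n\<close> to the target level. For \<open>u\<close>
  below level \<open>N\<close>, \<open>push\<close> annihilates its relator; the difference for
  \<open>u\<close> is then this relator plus the weighted differences for its successors.\<close>

lemma single_minus_push_in_span:
  assumes gg: "graded_graph G" and "u \<in> verts G" "grade G u + n = N"
  shows "Poly_Mapping.single u 1 - push G (level G N) (Poly_Mapping.single u 1)
    \<in> span (relator G ` verts G)"
  using assms(2,3)
proof (induction n arbitrary: u)
  case 0
  have "push G (level G N) (Poly_Mapping.single u 1) = Poly_Mapping.single u 1"
  proof -
    have "finite (level G N)" using gg by (simp add: graded_graph_def)
    moreover have "Poly_Mapping.single v (gdim G u v) = (if u = v then Poly_Mapping.single v 1 else 0)"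
      if "v \<in> level G N" for v
      using that 0 by (auto simp: level_def gdim_self gdim_eq_0)
    ultimately show ?thesis
      using 0 by (simp add: push_def pair_single level_def)
  qed
  then show ?case by (simp add: span_zero)
next
  case (Suc n)
  let ?T = "push G (level G N)"
  let ?e = "\<lambda>u. Poly_Mapping.single u (1::real)"
  have "?T (relator G u) = 0"
    unfolding push_def
  proof (rule sum.neutral, rule ballI)
    fix v assume "v \<in> level G N"
    then have "u \<noteq> v" using Suc.prems by (auto simp: level_def)
    then show "Poly_Mapping.single v (pair G v (relator G u)) = 0"
      using pair_relator[OF gg Suc.prems(1)] by simp
  qed
  then have "?T (?e u) = ?T (\<Sum>w\<in>succs G u. kap G u w *\<^sub>R ?e w)"
    by (simp add: relator_def scaleR_single linear_diff[OF linear_push])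
  then have "?e u - ?T (?e u) = relator G u + (\<Sum>w\<in>succs G u. kap G u w *\<^sub>R ?e w)
      - ?T (\<Sum>w\<in>succs G u. kap G u w *\<^sub>R ?e w)"
    by (simp add: relator_def scaleR_single)
  also have "\<dots> = relator G u + (\<Sum>w\<in>succs G u. kap G u w *\<^sub>R (?e w - ?T (?e w)))"
    by (simp only: linear_sum[OF linear_push] linear_cmul[OF linear_push] scaleR_diff_right
        sum_subtractf add_diff_eq)
  also have "\<dots> \<in> span (relator G ` verts G)"
  proof (intro span_add span_sum span_scale)
    show "relator G u \<in> span (relator G ` verts G)" using Suc.prems by (simp add: span_base)
  next
    fix w assume w: "w \<in> succs G u"
    then show "?e w - ?T (?e w) \<in> span (relator G ` verts G)"
      using Suc.prems grade_succs[OF w] succs_subset_verts[of G u] by (intro Suc.IH) auto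
  qed
  finally show ?case .
qed

lemma minus_push_in_span:
  assumes gg: "graded_graph G" and x: "x \<in> free_space G"
    and N: "\<And>u. u \<in> Poly_Mapping.keys x \<Longrightarrow> grade G u \<le> N"
  shows "x - push G (level G N) x \<in> span (relator G ` verts G)"
proof -
  let ?T = "push G (level G N)"
  let ?e = "\<lambda>u. Poly_Mapping.single u (1::real)"
  have x_eq: "x = (\<Sum>u\<in>Poly_Mapping.keys x. Poly_Mapping.lookup x u *\<^sub>R ?e u)"
  proof (rule poly_mapping_eqI)
    fix k
    have "Poly_Mapping.lookup x u * Poly_Mapping.lookup (?e u) k
        = (if k = u then Poly_Mapping.lookup x u else 0)" for u
      by (simp add: lookup_single when_def)
    then show "Poly_Mapping.lookup x k
        = Poly_Mapping.lookup (\<Sum>u\<in>Poly_Mapping.keys x. Poly_Mapping.lookup x u *\<^sub>R ?e u) k"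
      by (simp add: lookup_sum lookup_scaleR in_keys_iff)
  qed
  have "?T x = ?T (\<Sum>u\<in>Poly_Mapping.keys x. Poly_Mapping.lookup x u *\<^sub>R ?e u)"
    by (rule arg_cong[OF x_eq])
  also have "\<dots> = (\<Sum>u\<in>Poly_Mapping.keys x. Poly_Mapping.lookup x u *\<^sub>R ?T (?e u))"
    by (simp only: linear_sum[OF linear_push] linear_cmul[OF linear_push])
  finally have "x - ?T x = (\<Sum>u\<in>Poly_Mapping.keys x. Poly_Mapping.lookup x u *\<^sub>R ?e u)
      - (\<Sum>u\<in>Poly_Mapping.keys x. Poly_Mapping.lookup x u *\<^sub>R ?T (?e u))"
    by (rule arg_cong2[OF x_eq])
  also have "\<dots> = (\<Sum>u\<in>Poly_Mapping.keys x. Poly_Mapping.lookup x u *\<^sub>R (?e u - ?T (?e u)))"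
    by (simp only: scaleR_diff_right sum_subtractf)
  also have "\<dots> \<in> span (relator G ` verts G)"
  proof (intro span_sum span_scale)
    fix u assume u: "u \<in> Poly_Mapping.keys x"
    then have "u \<in> verts G" using x by (auto simp: free_space_def)
    moreover have "grade G u + (N - grade G u) = N" using N[OF u] by simp
    ultimately show "?e u - ?T (?e u) \<in> span (relator G ` verts G)"
      by (rule single_minus_push_in_span[OF gg])
  qed
  finally show ?thesis .
qed

lemma lookup_push:
  "finite S \<Longrightarrow> Poly_Mapping.lookup (push G S x) v = (if v \<in> S then pair G v x else 0)"
  by (simp add: push_def lookup_sum lookup_single when_def)

lemma push_nonneg:
  assumes "graded_graph G" "x \<in> nonneg_combs G" "finite S" "S \<subseteq> verts H"
  shows "push G S x \<in> nonneg_combs H"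
  using assms pair_nonneg[OF assms(1,2)]
  by (auto simp: nonneg_combs_def free_space_def lookup_push in_keys_iff split: if_splits)

text \<open>With positive weights, a finite average forces a finite value at every
  successor.\<close>

lemma graph_ideal_finiteness:
  assumes gg: "graded_graph G" and I: "graph_ideal G I" and f: "harmonic_on G I f"
  shows "graph_ideal G {u \<in> I. f u < \<infinity>}"
proof -
  have "f v < \<infinity>" if "u \<in> I" "f u < \<infinity>" "v \<in> succs G u" for u v
  proof -
    have "f u = step G f u" using f that(1) by (simp add: harmonic_on_def)
    then have "ennreal (kap G u v) * f v < \<infinity>"
      using that finite_succs[OF gg, of u] by (auto simp: step_def)
    then show ?thesis
      using kap_succs_pos[OF gg that(3)] by (auto simp: ennreal_mult_less_top)
  qed
  then show ?thesis using I by (auto simp: graph_ideal_iff)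
qed

section \<open>The supremum over the positive cone\<close>

text \<open>Admissible \<open>b\<close> have representatives supported on the finiteness ideal;
  compared with \<open>x\<close> on a high level, they stay below a level sum. Conversely, the part
  of \<open>x\<close> pushed to level \<open>N\<close> that falls in this ideal is admissible and
  attains the level sum. Taking all vertices for \<open>I\<close> gives the supremum in
  \<open>semifinite\<close>, a general \<open>I\<close> the formula for \<open>Ext\<close>.\<close>

lemma SUP_K0_val:
  assumes gg: "graded_graph G" and I: "graph_ideal G I" and f: "harmonic_on G I f"
    and x: "x \<in> nonneg_combs G"
  shows "(SUP b\<in>{b \<in> K0_plus (subgraph G I).
             K0_le G (K0_incl G b) (K0_rel G `` {x}) \<and> K0_val (subgraph G I) f b < \<infinity>}.
           K0_val (subgraph G I) f b) = eval_comb (lift G {u \<in> I. f u < \<infinity>} f) x"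
    (is "(SUP b\<in>?B. _) = _")
proof -
  let ?H = "subgraph G I"
  let ?J = "{u \<in> I. f u < \<infinity>}"
  let ?L = "\<lambda>N. {v \<in> ?J. grade G v = N}"
  have IG: "I \<subseteq> verts G" using I by (simp add: graph_ideal_def)
  have J: "graph_ideal G ?J" by (rule graph_ideal_finiteness[OF gg I f])
  have fJ: "harmonic_on G ?J f" by (rule harmonic_on_subset[OF f]) auto
  have xG: "x \<in> free_space G" using x nonneg_combs_subset by blast
  have nonneg_H: "nonneg_combs ?H \<subseteq> nonneg_combs G"
    using IG by (auto simp: nonneg_combs_def free_space_def)
  have val_H: "K0_val ?H f (K0_rel ?H `` {y}) = eval_comb f y" if "y \<in> nonneg_combs ?H" for y
    using that graded_graph_subgraph[OF gg I] f succs_subgraph[OF I]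
    by (intro K0_val_class) (simp_all add: harmonic_on_def step_def)
  have le_H: "K0_le G (K0_incl G (K0_rel ?H `` {y})) (K0_rel G `` {x})
    \<longleftrightarrow> (\<exists>z\<in>nonneg_combs G. x - y - z \<in> span (relator G ` verts G))" if "y \<in> nonneg_combs ?H" for y
  proof -
    have "y \<in> free_space ?H" "y \<in> free_space G"
      using that nonneg_H nonneg_combs_subset by blast+
    then show ?thesis by (simp only: K0_incl_class[OF I] K0_le_classes[OF xG])
  qed
  show ?thesis
  proof (rule antisym)
    show "(SUP b\<in>?B. K0_val ?H f b) \<le> eval_comb (lift G ?J f) x"
    proof (rule SUP_least)
      fix b assume b: "b \<in> ?B"
      then have "b \<in> K0_plus ?H" by simp
      then obtain y where y: "y \<in> nonneg_combs ?H" "b = K0_rel ?H `` {y}"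
        unfolding K0_plus_iff by blast
      then have yG: "y \<in> nonneg_combs G" using nonneg_H by blast
      obtain z where z: "z \<in> nonneg_combs G" "x - y - z \<in> span (relator G ` verts G)"
        using b le_H[OF y(1)] unfolding y(2) by blast
      have "eval_comb f y < \<infinity>" using b unfolding y(2) val_H[OF y(1), symmetric] by blast
      \<comment> \<open>An infinite value of \<open>f\<close> would survive multiplication by the
        strictly positive coefficient.\<close>
      then have "f u < \<infinity>" if "u \<in> Poly_Mapping.keys y" for u
      proof -
        have "ennreal (Poly_Mapping.lookup y u) * f u < \<infinity>"
          using that \<open>eval_comb f y < \<infinity>\<close> by (simp add: eval_comb_def)
        moreover have "0 < Poly_Mapping.lookup y u"
          using that yG by (simp add: nonneg_combs_def in_keys_iff less_le)
        ultimately show ?thesis by (auto simp: ennreal_mult_less_top)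
      qed
      then have "Poly_Mapping.keys y \<subseteq> ?J"
        using y(1) by (auto simp: nonneg_combs_def free_space_def)
      then obtain M where M: "\<And>N. N \<ge> M \<Longrightarrow> eval_comb f y = (\<Sum>v\<in>?L N. ennreal (pair G v y) * f v)"
        using eval_comb_eq_sum_pair[OF gg J fJ yG] by blast
      obtain M' where M': "\<And>v. M' < grade G v \<Longrightarrow> pair G v (x - y - z) = 0"
        using pair_span_relators[OF gg z(2)] by blast
      \<comment> \<open>Level \<open>N\<close> must be strictly above \<open>M'\<close>, where the
        relation becomes an identity of pairings, and at least \<open>M\<close>, where the value of
        \<open>y\<close> can be read off from them.\<close>
      define N where "N = Suc (M + M')"
      \<comment> \<open>In that identity the remainder \<open>z\<close> contributes a nonnegative
        term.\<close>
      have "pair G v y \<le> pair G v x" if "grade G v = N" for v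
        using M'[of v] that pair_nonneg[OF gg z(1), of v]
        by (simp add: N_def linear_diff[OF linear_pair])
      moreover have "eval_comb f y = (\<Sum>v\<in>?L N. ennreal (pair G v y) * f v)"
        by (rule M) (simp add: N_def)
      ultimately have "eval_comb f y \<le> (\<Sum>v\<in>?L N. ennreal (pair G v x) * f v)"
        by (auto intro!: sum_mono mult_right_mono ennreal_leI)
      also have "\<dots> \<le> eval_comb (lift G ?J f) x"
        unfolding sum_pair_level[OF gg x] eval_comb_def
        using xG by (intro sum_mono mult_left_mono level_sum_le_lift[OF gg J])
          (auto simp: free_space_def)
      finally show "K0_val ?H f b \<le> eval_comb (lift G ?J f) x" using val_H y by simp
    qed
  next
    have lim: "(\<lambda>N. eval_comb (\<lambda>u. level_sum G ?J f u N) x) \<longlonglongrightarrow> eval_comb (lift G ?J f) x"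
      unfolding eval_comb_def using xG
      by (intro tendsto_sum ennreal_tendsto_cmult level_sum_LIMSEQ[OF gg J fJ])
        (auto simp: free_space_def)
    have bound: "eval_comb (\<lambda>u. level_sum G ?J f u N) x \<le> (SUP b\<in>?B. K0_val ?H f b)"
      if N: "N \<ge> Max (grade G ` Poly_Mapping.keys x)" for N
    proof -
      \<comment> \<open>The pushed combination splits into its part in the finiteness ideal, which
        is the competitor, and the rest, which witnesses that the competitor lies below
        \<open>x\<close>.\<close>
      let ?y = "push G (?L N) x"
      let ?z = "push G (level G N - ?L N) x"
      have fin: "finite (?L N)" "finite (level G N)"
        using finite_ideal_level[OF gg J, of N] gg by (auto simp: graded_graph_def)
      have y: "?y \<in> nonneg_combs ?H"
        by (rule push_nonneg[OF gg x fin(1)]) auto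
      have z: "?z \<in> nonneg_combs G"
        by (rule push_nonneg[OF gg x]) (use fin in \<open>auto simp: level_def\<close>)
      have "?L N \<subseteq> level G N" using IG by (auto simp: level_def)
      then have "push G (level G N) x = ?y + ?z"
        unfolding push_def using fin(2) by (simp add: sum.subset_diff add.commute)
      moreover have "x - push G (level G N) x \<in> span (relator G ` verts G)"
      proof (rule minus_push_in_span[OF gg xG])
        fix u assume "u \<in> Poly_Mapping.keys x"
        then have "grade G u \<le> Max (grade G ` Poly_Mapping.keys x)" by (intro Max_ge) auto
        with N show "grade G u \<le> N" by simp
      qed
      ultimately have "x - ?y - ?z \<in> span (relator G ` verts G)" by (simp only: diff_diff_add)
      then have le: "K0_le G (K0_incl G (K0_rel ?H `` {?y})) (K0_rel G `` {x})"
        using z le_H[OF y] by blast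
      have "eval_comb f ?y = (\<Sum>v\<in>?L N. ennreal (Poly_Mapping.lookup ?y v) * f v)"
      proof (rule eval_comb_superset[OF fin(1)])
        show "Poly_Mapping.keys ?y \<subseteq> ?L N"
          unfolding subset_iff in_keys_iff lookup_push[OF fin(1)] by (metis (mono_tags))
      qed
      then have eval_y: "eval_comb f ?y = (\<Sum>v\<in>?L N. ennreal (pair G v x) * f v)"
        using fin(1) by (simp add: lookup_push)
      also have "\<dots> < \<infinity>"
        using fin(1) by (auto simp: ennreal_mult_less_top)
      finally have "K0_val ?H f (K0_rel ?H `` {?y}) < \<infinity>" unfolding val_H[OF y] .
      moreover have "K0_rel ?H `` {?y} \<in> K0_plus ?H" unfolding K0_plus_iff using y by blast
      ultimately have "K0_rel ?H `` {?y} \<in> ?B" using le by blast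
      then have "K0_val ?H f (K0_rel ?H `` {?y}) \<le> (SUP b\<in>?B. K0_val ?H f b)"
        by (rule SUP_upper)
      then show ?thesis
        using val_H[OF y] eval_y sum_pair_level[OF gg x, where J = ?J and N = N and f = f] by simp
    qed
    show "eval_comb (lift G ?J f) x \<le> (SUP b\<in>?B. K0_val ?H f b)"
      by (rule LIMSEQ_le_const2[OF lim]) (intro exI allI impI, rule bound)
  qed
qed

text \<open>Semifiniteness, tested a priori on all of the positive cone, is a condition on vertices:
  \<open>\<phi>\<close> is recovered by averaging from its values on the finiteness ideal.\<close>

lemma finite_or_semifinite_iff:
  assumes gg: "graded_graph G" and f: "harmonic_on G (verts G) f"
  shows "finite_fun G f \<or> semifinite G f
    \<longleftrightarrow> (\<forall>u\<in>verts G. lift G {u \<in> verts G. f u < \<infinity>} f u = f u)" (is "_ \<longleftrightarrow> (\<forall>u\<in>_. ?E u = f u)")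
proof -
  have incl: "K0_incl G b = b" if b: "b \<in> K0_plus G" for b
  proof -
    obtain y where "y \<in> nonneg_combs G" "b = K0_rel G `` {y}" using b unfolding K0_plus_iff by blast
    then show ?thesis
      using K0_incl_class[OF graph_ideal_verts, of y G] nonneg_combs_subset[of G] by auto
  qed
  define S where "S a = (SUP b\<in>{b \<in> K0_plus G. K0_le G b a \<and> K0_val G f b < \<infinity>}. K0_val G f b)"
    for a
  have S: "S (K0_rel G `` {x}) = eval_comb ?E x" if "x \<in> nonneg_combs G" for x
  proof -
    have "{b \<in> K0_plus G. K0_le G b (K0_rel G `` {x}) \<and> K0_val G f b < \<infinity>}
        = {b \<in> K0_plus G. K0_le G (K0_incl G b) (K0_rel G `` {x}) \<and> K0_val G f b < \<infinity>}"
      by (rule Collect_cong) (simp add: incl cong: conj_cong)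
    then show ?thesis using SUP_K0_val[OF gg graph_ideal_verts f that] by (simp add: S_def)
  qed
  have semi: "semifinite G f \<longleftrightarrow> \<not> finite_fun G f \<and> (\<forall>x\<in>nonneg_combs G. eval_comb f x = eval_comb ?E x)"
  proof -
    have ball: "(\<forall>a\<in>K0_plus G. P a) \<longleftrightarrow> (\<forall>x\<in>nonneg_combs G. P (K0_rel G `` {x}))" for P
    proof -
      have "K0_plus G = (\<lambda>x. K0_rel G `` {x}) ` nonneg_combs G"
        by (rule set_eqI) (simp only: image_iff K0_plus_iff)
      then show ?thesis by simp
    qed
    show ?thesis
      unfolding semifinite_def S_def[symmetric] ball by (simp add: K0_val_class[OF gg f] S cong: ball_cong)
  qed
  have "(\<forall>x\<in>nonneg_combs G. eval_comb f x = eval_comb ?E x) \<longleftrightarrow> (\<forall>u\<in>verts G. ?E u = f u)"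
  proof
    assume *: "\<forall>x\<in>nonneg_combs G. eval_comb f x = eval_comb ?E x"
    show "\<forall>u\<in>verts G. ?E u = f u"
    proof
      fix u assume "u \<in> verts G"
      then have "Poly_Mapping.single u 1 \<in> nonneg_combs G"
        by (simp add: nonneg_combs_def free_space_def lookup_single when_def)
      then show "?E u = f u" using * by (force simp: eval_comb_def)
    qed
  qed (auto simp: nonneg_combs_def free_space_def eval_comb_def intro!: sum.cong)
  \<comment> \<open>Finite functions meet the lifting condition as well, their finiteness ideal
    being everything; this merges the two alternatives into one.\<close>
  moreover have "\<forall>u\<in>verts G. ?E u = f u" if "finite_fun G f"
  proof -
    have "{u \<in> verts G. f u < \<infinity>} = verts G" using that by (auto simp: finite_fun_def)
    then show ?thesis using lift_eq[OF graph_ideal_verts f] by auto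
  qed
  ultimately show ?thesis using semi by blast
qed


section \<open>Restriction and extension\<close>

text \<open>The finite or semifinite harmonic functions on \<open>I\<close>, in a form that refers
  to the ambient graph only.\<close>

definition regular_on :: "'v ggraph \<Rightarrow> 'v set \<Rightarrow> ('v \<Rightarrow> ennreal) \<Rightarrow> bool" where
  "regular_on G I f \<longleftrightarrow> f \<in> extensional I \<and> harmonic_on G I f \<and>
     (\<forall>u\<in>I. lift G {u \<in> I. f u < \<infinity>} f u = f u)"

lemma regular_on_iff:
  assumes gg: "graded_graph G" and I: "graph_ideal G I"
  shows "harmonic (subgraph G I) f \<and> (finite_fun (subgraph G I) f \<or> semifinite (subgraph G I) f)
    \<longleftrightarrow> regular_on G I f"
proof (cases "harmonic (subgraph G I) f")
  case True
  then have "harmonic_on (subgraph G I) (verts (subgraph G I)) f" by (simp add: harmonic_iff)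
  from finite_or_semifinite_iff[OF graded_graph_subgraph[OF gg I] this] True show ?thesis
    by (simp add: harmonic_subgraph_iff[OF I] regular_on_def lift_subgraph[OF I])
qed (auto simp: harmonic_subgraph_iff[OF I] regular_on_def)

definition indecomposable_on :: "'v ggraph \<Rightarrow> 'v set \<Rightarrow> ('v \<Rightarrow> ennreal) \<Rightarrow> bool" where
  "indecomposable_on G I f \<longleftrightarrow>
     (\<forall>\<psi>. regular_on G I \<psi> \<and> (\<forall>u\<in>I. \<psi> u \<le> f u) \<and> nonvanishing_on {u \<in> I. f u < \<infinity>} \<psi> \<longrightarrow>
        (\<exists>c::real. 0 \<le> c \<and> (\<forall>u\<in>{u \<in> I. f u < \<infinity>}. \<psi> u = ennreal c * f u)))"

text \<open>A function that is not finite is \<infinity> somewhere, hence nonzero; so nonvanishing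
  can be imposed on both alternatives in \<open>Hex\<close> alike.\<close>

lemma Hex_subgraph_iff:
  assumes "graded_graph G" "graph_ideal G I"
  shows "f \<in> Hex (subgraph G I)
    \<longleftrightarrow> regular_on G I f \<and> nonvanishing_on I f \<and> indecomposable_on G I f"
proof -
  have "nonvanishing_on I f" if "\<not> finite_fun (subgraph G I) f"
    using that by (auto simp: finite_fun_def nonvanishing_on_def intro!: bexI)
  then have "semifinite (subgraph G I) f \<Longrightarrow> nonvanishing_on I f"
    by (simp add: semifinite_def)
  moreover have "indecomposable (subgraph G I) f \<longleftrightarrow> indecomposable_on G I f"
    unfolding indecomposable_def indecomposable_on_def finiteness_ideal_def verts_subgraph
      regular_on_iff[OF assms, symmetric] by simp
  ultimately show ?thesis
    unfolding Hex_def regular_on_iff[OF assms, symmetric] verts_subgraph by blast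
qed

lemma Hex_iff:
  assumes "graded_graph G"
  shows "f \<in> Hex G \<longleftrightarrow>
    regular_on G (verts G) f \<and> nonvanishing_on (verts G) f \<and> indecomposable_on G (verts G) f"
  using Hex_subgraph_iff[OF assms graph_ideal_verts] by simp

text \<open>A regular function is recovered from its finiteness ideal by averaging, and averaging
  zero gives zero.\<close>

lemma regular_on_nonvanishing:
  assumes "regular_on G I f" "nonvanishing_on I f"
  shows "nonvanishing_on {u \<in> I. f u < \<infinity>} f"
proof (rule ccontr)
  assume "\<not> nonvanishing_on {u \<in> I. f u < \<infinity>} f"
  then have "lift G {u \<in> I. f u < \<infinity>} f u = 0 * lift G {u \<in> I. f u < \<infinity>} f u" for u
    by (intro lift_cmult) (simp add: nonvanishing_on_def)
  then show False using assms by (auto simp: regular_on_def nonvanishing_on_def)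
qed

text \<open>By regularity the lift from the finiteness ideal already coincides with \<open>f\<close>
  on \<open>I\<close>, so minimality bounds the lift from \<open>I\<close> by it.\<close>

lemma lift_finite_part:
  assumes gg: "graded_graph G" and I: "graph_ideal G I" and f: "regular_on G I f"
    and u: "u \<in> verts G"
  shows "lift G {u \<in> I. f u < \<infinity>} f u = lift G I f u"
proof (rule antisym)
  have h: "harmonic_on G I f" using f by (simp add: regular_on_def)
  let ?J = "{u \<in> I. f u < \<infinity>}"
  show "lift G ?J f u \<le> lift G I f u" by (rule lift_mono) auto
  have "graph_ideal G ?J" by (rule graph_ideal_finiteness[OF gg I h])
  moreover have "harmonic_on G ?J f" by (rule harmonic_on_subset[OF h]) auto
  ultimately have "harmonic_on G (verts G) (lift G ?J f)" by (rule harmonic_on_lift)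
  then show "lift G I f u \<le> lift G ?J f u"
    using f u by (intro lift_le[OF graph_ideal_verts]) (auto simp: regular_on_def)
qed

text \<open>Seen from a vertex of \<open>I\<close>, the lift from the finiteness ideal of
  \<open>f\<close> depends only on its part inside \<open>I\<close>, which is the finiteness ideal
  of the restriction.\<close>

lemma regular_on_restrict:
  assumes I: "graph_ideal G I" and f: "regular_on G (verts G) f"
  shows "regular_on G I (restrict f I)"
proof -
  have IG: "I \<subseteq> verts G" using I by (simp add: graph_ideal_def)
  let ?F = "{u \<in> verts G. f u < \<infinity>}"
  have "{u \<in> I. restrict f I u < \<infinity>} = ?F \<inter> I" using IG by auto
  moreover have "lift G (?F \<inter> I) (restrict f I) u = f u" if "u \<in> I" for u
  proof -
    have "lift G (?F \<inter> I) (restrict f I) u = lift G (?F \<inter> I) f u" by (rule lift_cong) simp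
    also have "\<dots> = lift G ?F f u" by (rule lift_Int[OF I that])
    finally show ?thesis using f that IG by (auto simp: regular_on_def)
  qed
  moreover have "harmonic_on G I (restrict f I)"
    unfolding harmonic_on_def
  proof
    fix u assume u: "u \<in> I"
    then have "step G (restrict f I) u = step G f u"
      using I by (intro step_cong) (auto simp: graph_ideal_iff)
    then show "restrict f I u = step G (restrict f I) u"
      using f u IG by (auto simp: regular_on_def harmonic_on_def)
  qed
  ultimately show ?thesis by (simp add: regular_on_def)
qed

text \<open>Lifting from the finiteness ideal of \<open>f\<close> gives the whole extension, and
  that ideal is contained in the finiteness ideal of the extension. The reverse bound is
  minimality.\<close>

lemma regular_on_extend:
  assumes gg: "graded_graph G" and I: "graph_ideal G I" and f: "regular_on G I f"
  shows "regular_on G (verts G) (restrict (lift G I f) (verts G))"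
    (is "regular_on G _ ?\<Phi>")
proof -
  have IG: "I \<subseteq> verts G" using I by (simp add: graph_ideal_def)
  have h: "harmonic_on G I f" using f by (simp add: regular_on_def)
  have eq: "?\<Phi> u = f u" if "u \<in> I" for u using that IG lift_eq[OF I h that] by auto
  have \<Phi>: "harmonic_on G (verts G) ?\<Phi>"
    unfolding harmonic_on_def
  proof
    fix u assume "u \<in> verts G"
    moreover have "step G ?\<Phi> u = step G (lift G I f) u"
      using succs_subset_verts[of G u] by (intro step_cong) auto
    ultimately show "?\<Phi> u = step G ?\<Phi> u" using step_lift[OF I h, of u] by simp
  qed
  have "lift G {u \<in> verts G. ?\<Phi> u < \<infinity>} ?\<Phi> u = ?\<Phi> u" if u: "u \<in> verts G" for u
  proof (rule antisym)
    show "lift G {u \<in> verts G. ?\<Phi> u < \<infinity>} ?\<Phi> u \<le> ?\<Phi> u"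
      by (rule lift_le[OF graph_ideal_verts \<Phi> u]) simp
    have "?\<Phi> u = lift G {u \<in> I. f u < \<infinity>} f u"
      using u lift_finite_part[OF gg I f u] by simp
    also have "\<dots> \<le> lift G {u \<in> verts G. ?\<Phi> u < \<infinity>} ?\<Phi> u"
    proof (rule lift_mono)
      show "{u \<in> I. f u < \<infinity>} \<subseteq> {u \<in> verts G. ?\<Phi> u < \<infinity>}"
      proof
        fix u assume "u \<in> {u \<in> I. f u < \<infinity>}"
        then show "u \<in> {u \<in> verts G. ?\<Phi> u < \<infinity>}" using eq[of u] IG by auto
      qed
      show "f v \<le> ?\<Phi> v" if "v \<in> {u \<in> I. f u < \<infinity>}" for v using that eq[of v] by simp
    qed
    finally show "?\<Phi> u \<le> lift G {u \<in> verts G. ?\<Phi> u < \<infinity>} ?\<Phi> u" .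
  qed
  then show ?thesis using \<Phi> by (simp add: regular_on_def)
qed

section \<open>Correspondence of indecomposable functions\<close>

lemma Res_Ext:
  assumes "graded_graph G" "graph_ideal G I" "f \<in> extensional I" "harmonic_on G I f"
  shows "Res I (Ext G I f) = f"
proof -
  have "I \<subseteq> verts G" using assms(2) by (simp add: graph_ideal_def)
  then show ?thesis
    using assms lift_eq[OF assms(2,4)]
    by (auto simp: Res_def Ext_eq_lift extensional_def fun_eq_iff restrict_def)
qed

text \<open>Minorants of \<open>\<phi>\<close> on \<open>I\<close> extend to minorants on the whole
  graph, where indecomposability applies; restricting back gives proportionality on
  \<open>I\<close>.\<close>

lemma Res_in_Hex:
  assumes gg: "graded_graph G" and I: "graph_ideal G I"
    and \<phi>: "\<phi> \<in> Hex G" "nonvanishing_on I \<phi>"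
  shows "Ext G I (Res I \<phi>) = \<phi>" "Res I \<phi> \<in> Hex (subgraph G I)"
proof -
  have IG: "I \<subseteq> verts G" using I by (simp add: graph_ideal_def)
  let ?F = "{u \<in> verts G. \<phi> u < \<infinity>}"
  have reg: "regular_on G (verts G) \<phi>" and ind: "indecomposable_on G (verts G) \<phi>"
    using \<phi>(1) by (simp_all add: Hex_iff[OF gg])
  then have h: "harmonic_on G (verts G) \<phi>" by (simp add: regular_on_def)
  have regI: "regular_on G I (Res I \<phi>)"
    unfolding Res_def by (rule regular_on_restrict[OF I reg])
  have nv: "nonvanishing_on I (Res I \<phi>)"
    using \<phi>(2) by (auto simp: nonvanishing_on_def Res_def)
  \<comment> \<open>Used twice: with the restriction of \<open>\<phi>\<close> it identifies the
    extension of that restriction, with an arbitrary minorant it gives indecomposability on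
    \<open>I\<close>.\<close>
  have multiple: "\<exists>c::real. 0 \<le> c \<and> (\<forall>u\<in>?F. Ext G I \<psi> u = ennreal c * \<phi> u)"
    and ext_le: "\<And>u. u \<in> verts G \<Longrightarrow> Ext G I \<psi> u \<le> \<phi> u"
    if \<psi>: "regular_on G I \<psi>" "\<And>u. u \<in> I \<Longrightarrow> \<psi> u \<le> \<phi> u"
      "nonvanishing_on {u \<in> I. \<phi> u < \<infinity>} \<psi>" for \<psi>
  proof -
    have h\<psi>: "harmonic_on G I \<psi>" using \<psi>(1) by (simp add: regular_on_def)
    show le: "Ext G I \<psi> u \<le> \<phi> u" if "u \<in> verts G" for u
      using that \<psi>(2) by (auto simp: Ext_eq_lift[OF gg I h\<psi>] intro!: lift_le[OF graph_ideal_verts h])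
    have "regular_on G (verts G) (Ext G I \<psi>)"
      unfolding Ext_eq_lift[OF gg I h\<psi>] by (rule regular_on_extend[OF gg I \<psi>(1)])
    moreover have "nonvanishing_on ?F (Ext G I \<psi>)"
      using \<psi>(3) IG lift_eq[OF I h\<psi>]
      by (force simp: nonvanishing_on_def Ext_eq_lift[OF gg I h\<psi>])
    ultimately show "\<exists>c::real. 0 \<le> c \<and> (\<forall>u\<in>?F. Ext G I \<psi> u = ennreal c * \<phi> u)"
      using ind le unfolding indecomposable_on_def by blast
  qed
  let ?\<psi> = "Ext G I (Res I \<phi>)"
  have "{u \<in> I. Res I \<phi> u < \<infinity>} = {u \<in> I. \<phi> u < \<infinity>}" by (auto simp: Res_def)
  then have nvF: "nonvanishing_on {u \<in> I. \<phi> u < \<infinity>} (Res I \<phi>)"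
    using regular_on_nonvanishing[OF regI nv] by simp
  have Res_le: "Res I \<phi> u \<le> \<phi> u" if "u \<in> I" for u using that by (simp add: Res_def)
  obtain c where c: "0 \<le> c" "\<And>u. u \<in> ?F \<Longrightarrow> ?\<psi> u = ennreal c * \<phi> u"
    using multiple[OF regI Res_le nvF] by blast
  have "Res I \<phi> \<in> extensional I" "harmonic_on G I (Res I \<phi>)"
    using regI by (simp_all add: regular_on_def)
  note ResExt = Res_Ext[OF gg I this] and lift = Ext_eq_lift[OF gg I this(2)]
  \<comment> \<open>The value at \<open>w\<close> is neither 0 nor \<infinity>, so it may be
    cancelled and the factor is 1.\<close>
  obtain w where w: "w \<in> I" "\<phi> w < \<infinity>" "\<phi> w \<noteq> 0"
    using nvF by (auto simp: nonvanishing_on_def Res_def)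
  have "ennreal c * \<phi> w = \<phi> w"
    using c(2)[of w] w IG fun_cong[OF ResExt, of w] by (auto simp: Res_def)
  then have c1: "ennreal c = 1" using w ennreal_mult_cancel_left[of "\<phi> w" "ennreal c" 1]
    by (auto simp: mult.commute)
  show "?\<psi> = \<phi>"
  proof
    fix u
    show "?\<psi> u = \<phi> u"
    proof (cases "u \<in> verts G")
      case True
      have h\<psi>: "harmonic_on G (verts G) ?\<psi>"
        using regular_on_extend[OF gg I regI] by (simp add: lift regular_on_def)
      \<comment> \<open>Proportionality speaks only of points where \<open>\<phi>\<close> is finite;
        regularity expresses \<open>\<phi>\<close> everywhere by its values there, and minimality
        bounds this lift by \<open>?\<psi>\<close>.\<close>
      have "\<phi> u = lift G ?F \<phi> u" using reg True by (simp add: regular_on_def)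
      also have "\<dots> \<le> ?\<psi> u"
        by (rule lift_le[OF graph_ideal_verts h\<psi> True]) (use c(2) c1 in auto)
      finally show ?thesis using ext_le[OF regI Res_le nvF True] by simp
    next
      case False
      then show ?thesis using reg by (simp add: lift regular_on_def extensional_def)
    qed
  qed
  have "indecomposable_on G I (Res I \<phi>)"
    unfolding indecomposable_on_def
  proof (intro allI impI, elim conjE)
    fix \<psi> assume \<psi>: "regular_on G I \<psi>" "\<forall>u\<in>I. \<psi> u \<le> Res I \<phi> u"
      and n: "nonvanishing_on {u \<in> I. Res I \<phi> u < \<infinity>} \<psi>"
    have "nonvanishing_on {u \<in> I. \<phi> u < \<infinity>} \<psi>" using n by (auto simp: nonvanishing_on_def Res_def)
    moreover have "\<And>u. u \<in> I \<Longrightarrow> \<psi> u \<le> \<phi> u" using \<psi>(2) by (simp add: Res_def)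
    ultimately obtain d where d: "0 \<le> d" "\<And>u. u \<in> ?F \<Longrightarrow> Ext G I \<psi> u = ennreal d * \<phi> u"
      using multiple[OF \<psi>(1)] by blast
    have R: "Res I (Ext G I \<psi>) = \<psi>"
      using \<psi>(1) by (intro Res_Ext[OF gg I]) (simp_all add: regular_on_def)
    have "\<psi> u = ennreal d * Res I \<phi> u" if "u \<in> {u \<in> I. Res I \<phi> u < \<infinity>}" for u
      using d(2)[of u] that IG fun_cong[OF R, of u] by (auto simp: Res_def)
    then show "\<exists>c::real. 0 \<le> c \<and> (\<forall>u\<in>{u \<in> I. Res I \<phi> u < \<infinity>}. \<psi> u = ennreal c * Res I \<phi> u)"
      using d(1) by blast
  qed
  then show "Res I \<phi> \<in> Hex (subgraph G I)"
    using regI nv by (simp add: Hex_subgraph_iff[OF gg I])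
qed

text \<open>Where the extension is finite, a minorant of it is the lift of its own values on the
  finiteness ideal of \<open>\<phi>\<close>, by \<open>lift_dominated\<close>. A proportionality
  found on that ideal is then transported by \<open>lift_cmult\<close>.\<close>

lemma Ext_in_Hex:
  assumes gg: "graded_graph G" and I: "graph_ideal G I" and \<phi>: "\<phi> \<in> Hex (subgraph G I)"
  shows "Res I (Ext G I \<phi>) = \<phi>" "nonvanishing_on I (Ext G I \<phi>)" "Ext G I \<phi> \<in> Hex G"
proof -
  have IG: "I \<subseteq> verts G" using I by (simp add: graph_ideal_def)
  let ?J = "{u \<in> I. \<phi> u < \<infinity>}"
  let ?\<Phi> = "Ext G I \<phi>"
  have reg: "regular_on G I \<phi>" and ind: "indecomposable_on G I \<phi>" and nv: "nonvanishing_on I \<phi>"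
    using \<phi> by (simp_all add: Hex_subgraph_iff[OF gg I])
  then have h: "harmonic_on G I \<phi>" by (simp add: regular_on_def)
  note lift = Ext_eq_lift[OF gg I h]
  have reg\<Phi>: "regular_on G (verts G) ?\<Phi>"
    unfolding lift by (rule regular_on_extend[OF gg I reg])
  then have h\<Phi>: "harmonic_on G (verts G) ?\<Phi>" by (simp add: regular_on_def)
  have eq: "?\<Phi> u = \<phi> u" if "u \<in> I" for u
    using that IG by (auto simp: lift lift_eq[OF I h])
  show "Res I ?\<Phi> = \<phi>"
    using reg by (intro Res_Ext[OF gg I]) (simp_all add: regular_on_def)
  show nvI: "nonvanishing_on I ?\<Phi>" using nv eq by (auto simp: nonvanishing_on_def)
  have J: "graph_ideal G ?J" by (rule graph_ideal_finiteness[OF gg I h])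
  have lift\<Phi>: "lift G ?J ?\<Phi> u = ?\<Phi> u" if "u \<in> verts G" for u
  proof -
    have "lift G ?J ?\<Phi> u = lift G ?J \<phi> u" by (rule lift_cong) (simp add: eq)
    then show ?thesis using that lift_finite_part[OF gg I reg that] by (simp add: lift)
  qed
  have "indecomposable_on G (verts G) ?\<Phi>"
    unfolding indecomposable_on_def
  proof (intro allI impI, elim conjE)
    fix \<psi> assume \<psi>: "regular_on G (verts G) \<psi>" and le: "\<forall>u\<in>verts G. \<psi> u \<le> ?\<Phi> u"
      and n: "nonvanishing_on {u \<in> verts G. ?\<Phi> u < \<infinity>} \<psi>"
    have h\<psi>: "harmonic_on G (verts G) \<psi>" using \<psi> by (simp add: regular_on_def)
    have lift\<psi>: "lift G ?J \<psi> u = \<psi> u" if "u \<in> verts G" "?\<Phi> u < \<infinity>" for u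
      using le by (intro lift_dominated[OF J h\<psi> h\<Phi> _ that lift\<Phi>[OF that(1)]]) simp
    have multiple: "\<psi> u = ennreal c * ?\<Phi> u"
      if "\<And>v. v \<in> ?J \<Longrightarrow> \<psi> v = ennreal c * \<phi> v" "u \<in> verts G" "?\<Phi> u < \<infinity>" for c u
    proof -
      have "lift G ?J \<psi> u = ennreal c * lift G ?J ?\<Phi> u"
        by (rule lift_cmult) (use that(1) eq in auto)
      then show ?thesis using lift\<psi> lift\<Phi> that by simp
    qed
    \<comment> \<open>Indecomposability of \<open>\<phi>\<close> asks for a minorant that is nonzero
      on \<open>?J\<close>. If \<open>\<psi>\<close> vanished there, transport with factor 0 would
      make it vanish wherever \<open>?\<Phi>\<close> is finite.\<close>
    have "nonvanishing_on ?J \<psi>"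
    proof (rule ccontr)
      assume "\<not> nonvanishing_on ?J \<psi>"
      then have "\<psi> v = ennreal 0 * \<phi> v" if "v \<in> ?J" for v
        using that by (auto simp: nonvanishing_on_def)
      then have "\<psi> u = 0" if "u \<in> verts G" "?\<Phi> u < \<infinity>" for u
        using multiple[of 0 u] that by simp
      then show False using n by (auto simp: nonvanishing_on_def)
    qed
    then have "nonvanishing_on ?J (restrict \<psi> I)" by (auto simp: nonvanishing_on_def)
    moreover have "\<forall>u\<in>I. restrict \<psi> I u \<le> \<phi> u"
      using le eq IG by (metis restrict_apply' subsetD)
    moreover have "regular_on G I (restrict \<psi> I)" by (rule regular_on_restrict[OF I \<psi>])
    ultimately obtain c :: real where c: "0 \<le> c" "\<forall>u\<in>?J. restrict \<psi> I u = ennreal c * \<phi> u"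
      using ind unfolding indecomposable_on_def by blast
    then have "\<psi> v = ennreal c * \<phi> v" if "v \<in> ?J" for v using that by simp
    then show "\<exists>c::real. 0 \<le> c \<and> (\<forall>u\<in>{u \<in> verts G. ?\<Phi> u < \<infinity>}. \<psi> u = ennreal c * ?\<Phi> u)"
      using multiple c(1) by blast
  qed
  moreover have "nonvanishing_on (verts G) ?\<Phi>"
    using nvI IG by (auto simp: nonvanishing_on_def)
  ultimately show "?\<Phi> \<in> Hex G" using reg\<Phi> by (simp add: Hex_iff[OF gg])
qed

text \<open>On a nonnegative representative of \<open>a\<close>, both sides are the value of the
  lift from the finiteness ideal of \<open>\<phi>\<close>, which equals the lift from
  \<open>I\<close>.\<close>

lemma K0_val_Ext:
  assumes gg: "graded_graph G" and I: "graph_ideal G I" and \<phi>: "regular_on G I \<phi>"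
    and a: "a \<in> K0_plus G"
  shows "K0_val G (Ext G I \<phi>) a =
    (SUP b\<in>{b \<in> K0_plus (subgraph G I).
        K0_le G (K0_incl G b) a \<and> K0_val (subgraph G I) \<phi> b < \<infinity>}. K0_val (subgraph G I) \<phi> b)"
proof -
  have h: "harmonic_on G I \<phi>" using \<phi> by (simp add: regular_on_def)
  obtain x where x: "x \<in> nonneg_combs G" "a = K0_rel G `` {x}"
    using a unfolding K0_plus_iff by blast
  have "harmonic_on G (verts G) (Ext G I \<phi>)"
    using regular_on_extend[OF gg I \<phi>] by (simp add: Ext_eq_lift[OF gg I h] regular_on_def)
  then have "K0_val G (Ext G I \<phi>) a = eval_comb (Ext G I \<phi>) x"
    unfolding x(2) by (rule K0_val_class[OF gg _ x(1)])
  also have "\<dots> = eval_comb (lift G {u \<in> I. \<phi> u < \<infinity>} \<phi>) x"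
    using x(1) lift_finite_part[OF gg I \<phi>]
    by (auto simp: eval_comb_def Ext_eq_lift[OF gg I h] nonneg_combs_def free_space_def
        intro!: sum.cong)
  finally show ?thesis
    unfolding x(2) SUP_K0_val[OF gg I h x(1)] .
qed

section \<open>Strict positivity in primitive graphs\<close>

text \<open>With positive weights a vanishing average forces every successor to vanish, so the zero
  set of a harmonic function is an ideal.\<close>

lemma harmonic_zero_above:
  assumes gg: "graded_graph G" and f: "harmonic_on G (verts G) f"
    and "above G w u" "f u = 0"
  shows "f w = 0"
proof -
  have "graph_ideal G {v \<in> verts G. f v = 0}"
    unfolding graph_ideal_iff
  proof (intro conjI ballI subsetI)
    fix u v assume u: "u \<in> {v \<in> verts G. f v = 0}" and v: "v \<in> succs G u"
    then have "(\<Sum>w\<in>succs G u. ennreal (kap G u w) * f w) = 0"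
      using f by (auto simp: harmonic_on_def step_def)
    then have "ennreal (kap G u v) * f v = 0" using v finite_succs[OF gg] by (simp add: sum_eq_0_iff)
    then show "v \<in> {v \<in> verts G. f v = 0}"
      using kap_succs_pos[OF gg v] succs_subset_verts[of G u] v by auto
  qed auto
  moreover have "u \<in> verts G" "w \<in> verts G"
    using assms(3) hd_in_set last_in_set unfolding above_def gpaths_def by blast+
  ultimately show ?thesis using assms(3,4) unfolding graph_ideal_def by blast
qed

lemma Hex_pos_Res_iff:
  assumes gg: "graded_graph G" and I: "graph_ideal G I" and prim: "primitive_graph G"
    and \<phi>: "\<phi> \<in> Hex G" "nonvanishing_on I \<phi>"
  shows "\<phi> \<in> Hex_pos G \<longleftrightarrow> Res I \<phi> \<in> Hex_pos (subgraph G I)"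
proof -
  have IG: "I \<subseteq> verts G" using I by (simp add: graph_ideal_def)
  have h: "harmonic_on G (verts G) \<phi>" using \<phi>(1) by (simp add: Hex_iff[OF gg] regular_on_def)
  obtain w where w: "w \<in> I" using \<phi>(2) by (auto simp: nonvanishing_on_def)
  have "0 < \<phi> u" if pos: "\<forall>v\<in>I. 0 < \<phi> v" and u: "u \<in> verts G" for u
  proof (rule ccontr)
    assume "\<not> 0 < \<phi> u"
    then have u0: "\<phi> u = 0" by simp
    \<comment> \<open>A common upper bound of \<open>u\<close> and of a vertex of \<open>I\<close>
      lies in \<open>I\<close>, and a zero at \<open>u\<close> would propagate to it.\<close>
    obtain z where z: "z \<in> verts G" "above G z u" "above G z w"
      using prim u w IG unfolding primitive_graph_def by blast
    then have "z \<in> I" using I w by (auto simp: graph_ideal_def)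
    then show False using pos harmonic_zero_above[OF gg h z(2) u0] by auto
  qed
  then have "(\<forall>u\<in>verts G. 0 < \<phi> u) \<longleftrightarrow> (\<forall>u\<in>I. 0 < \<phi> u)" using IG by blast
  then show ?thesis using \<phi> Res_in_Hex(2)[OF gg I \<phi>] by (simp add: Hex_pos_def Res_def)
qed

text \<open>Convergence is a separate clause because \<open>lim\<close> of a divergent sequence is
  an unspecified value. The last clause asks for nonempty \<open>I\<close>: over the empty ideal
  \<open>Hex\<close> has no elements, while strictly positive functions on the whole graph may
  exist.\<close>

theorem theorem3p14:
  fixes \<Gamma> :: "'v ggraph" and I :: "'v set"
  assumes graph: "graded_graph \<Gamma>" and ideal: "graph_ideal \<Gamma> I"
  shows
    "(bij_betw (Res I) {\<phi> \<in> Hex \<Gamma>. nonvanishing_on I \<phi>} (Hex (subgraph \<Gamma> I)) \<and>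
      bij_betw (Ext \<Gamma> I) (Hex (subgraph \<Gamma> I)) {\<phi> \<in> Hex \<Gamma>. nonvanishing_on I \<phi>} \<and>
      (\<forall>\<phi>\<in>{\<phi> \<in> Hex \<Gamma>. nonvanishing_on I \<phi>}. Ext \<Gamma> I (Res I \<phi>) = \<phi>) \<and>
      (\<forall>\<phi>\<in>Hex (subgraph \<Gamma> I). Res I (Ext \<Gamma> I \<phi>) = \<phi>) \<and>
      (\<forall>\<phi>\<in>Hex (subgraph \<Gamma> I). \<forall>u\<in>verts \<Gamma>. convergent (level_sum \<Gamma> I \<phi> u)) \<and>
      (\<forall>\<phi>\<in>Hex (subgraph \<Gamma> I). \<forall>a\<in>K0_plus \<Gamma>.
         K0_val \<Gamma> (Ext \<Gamma> I \<phi>) a =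
           (SUP b\<in>{b \<in> K0_plus (subgraph \<Gamma> I).
                     K0_le \<Gamma> (K0_incl \<Gamma> b) a \<and> K0_val (subgraph \<Gamma> I) \<phi> b < \<infinity>}.
              K0_val (subgraph \<Gamma> I) \<phi> b))) \<and>
     (primitive_graph \<Gamma> \<longrightarrow>
        (\<forall>\<phi>\<in>{\<phi> \<in> Hex \<Gamma>. nonvanishing_on I \<phi>}.
           \<phi> \<in> Hex_pos \<Gamma> \<longleftrightarrow> Res I \<phi> \<in> Hex_pos (subgraph \<Gamma> I)) \<and>
        (I \<noteq> {} \<longrightarrow>
           bij_betw (Res I) (Hex_pos \<Gamma>) (Hex_pos (subgraph \<Gamma> I)) \<and>
           bij_betw (Ext \<Gamma> I) (Hex_pos (subgraph \<Gamma> I)) (Hex_pos \<Gamma>)))"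
proof -
  note Res = Res_in_Hex[OF graph ideal] and Ext = Ext_in_Hex[OF graph ideal]
  let ?A = "{\<phi> \<in> Hex \<Gamma>. nonvanishing_on I \<phi>}" and ?B = "Hex (subgraph \<Gamma> I)"
  have inv: "\<forall>\<phi>\<in>?A. Ext \<Gamma> I (Res I \<phi>) = \<phi>" "\<forall>\<phi>\<in>?B. Res I (Ext \<Gamma> I \<phi>) = \<phi>"
    using Res(1) Ext(1) by simp_all
  moreover have "Res I ` ?A \<subseteq> ?B" using Res(2) by auto
  moreover have "Ext \<Gamma> I ` ?B \<subseteq> ?A" using Ext(2,3) by auto
  ultimately have bij: "bij_betw (Res I) ?A ?B" "bij_betw (Ext \<Gamma> I) ?B ?A"
    by (simp_all add: bij_betw_byWitness)
  have conv: "\<forall>\<phi>\<in>?B. \<forall>u\<in>verts \<Gamma>. convergent (level_sum \<Gamma> I \<phi> u)"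
    by (auto simp: Hex_subgraph_iff[OF graph ideal] regular_on_def
        intro!: convergentI level_sum_LIMSEQ[OF graph ideal])
  have val: "\<forall>\<phi>\<in>?B. \<forall>a\<in>K0_plus \<Gamma>. K0_val \<Gamma> (Ext \<Gamma> I \<phi>) a =
      (SUP b\<in>{b \<in> K0_plus (subgraph \<Gamma> I).
          K0_le \<Gamma> (K0_incl \<Gamma> b) a \<and> K0_val (subgraph \<Gamma> I) \<phi> b < \<infinity>}. K0_val (subgraph \<Gamma> I) \<phi> b)"
    using K0_val_Ext[OF graph ideal] by (simp add: Hex_subgraph_iff[OF graph ideal])
  have pos: "\<forall>\<phi>\<in>?A. \<phi> \<in> Hex_pos \<Gamma> \<longleftrightarrow> Res I \<phi> \<in> Hex_pos (subgraph \<Gamma> I)"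
    if "primitive_graph \<Gamma>"
    using Hex_pos_Res_iff[OF graph ideal that] by blast
  have bij_pos: "bij_betw (Res I) (Hex_pos \<Gamma>) (Hex_pos (subgraph \<Gamma> I)) \<and>
      bij_betw (Ext \<Gamma> I) (Hex_pos (subgraph \<Gamma> I)) (Hex_pos \<Gamma>)"
    if prim: "primitive_graph \<Gamma>" and "I \<noteq> {}"
  proof -
    \<comment> \<open>A strictly positive function is nonzero at any vertex of \<open>I\<close>;
      nonemptiness of \<open>I\<close> enters here.\<close>
    have A: "Hex_pos \<Gamma> \<subseteq> ?A"
      using \<open>I \<noteq> {}\<close> ideal by (force simp: Hex_pos_def nonvanishing_on_def graph_ideal_def)
    have B: "Hex_pos (subgraph \<Gamma> I) \<subseteq> ?B" by (auto simp: Hex_pos_def)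
    have "Res I ` Hex_pos \<Gamma> \<subseteq> Hex_pos (subgraph \<Gamma> I)" using A pos[OF prim] by blast
    moreover have "Ext \<Gamma> I ` Hex_pos (subgraph \<Gamma> I) \<subseteq> Hex_pos \<Gamma>"
    proof (rule image_subsetI)
      fix \<phi> assume pos\<phi>: "\<phi> \<in> Hex_pos (subgraph \<Gamma> I)"
      then have \<phi>: "\<phi> \<in> ?B" using B by blast
      then show "Ext \<Gamma> I \<phi> \<in> Hex_pos \<Gamma>" using pos[OF prim] Ext[OF \<phi>] pos\<phi> by simp
    qed
    moreover have "\<forall>\<phi>\<in>Hex_pos \<Gamma>. Ext \<Gamma> I (Res I \<phi>) = \<phi>" using A inv(1) by blast
    moreover have "\<forall>\<phi>\<in>Hex_pos (subgraph \<Gamma> I). Res I (Ext \<Gamma> I \<phi>) = \<phi>" using B inv(2) by blast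
    ultimately show ?thesis by (simp add: bij_betw_byWitness)
  qed
  show ?thesis using bij inv conv val pos bij_pos by (intro conjI impI) simp_all
qed

end
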